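(* Let $p_0,p_1,p_2,p_3\in[0,1]$ and assume that the spin system on ${\bf Z}$ with parameter vector $(p_0,p_1,p_2,p_3)$ is ergodic with unique stationary distribution $\pi$. Let $\hat S_t$ be the cumulative profit at time $t$ to player $0$ who, along with infinitely many other players, plays according to the spin system model. Then $\lim_{t\to\infty}t^{-1}\hat S_t=\mu$ a.s., where the mean parameter $\mu$ can be expressed in terms of the two-dimensional marginals $\cdots=\pi_{-2,0}=\pi_{-1,1}=\pi_{0,2}=\cdots$ of $\pi$ as $$\mu=\sum_{u=0}^1\sum_{v=0}^1\pi_{-1,1}(u,v)(p_{2u+v}-q_{2u+v})=2[\pi_{-1,1}(0,0)p_0+\pi_{-1,1}(0,1)p_1+\pi_{-1,1}(1,0)p_2+\pi_{-1,1}(1,1)p_3]-1,$$ or in terms of the one-dimensional marginals $\cdots=\pi_{-1}=\pi_0=\pi_1=\cdots$ of $\pi$ as $$\mu=\pi_0(1)-\pi_0(0)=2\pi_0(1)-1.$$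
   Context: Put $q_m:=1-p_m$. For $\boldsymbol x\in\{0,1\}^{\bf Z}$ let $m_i(\boldsymbol x):=2x_{i-1}+x_{i+1}$ and let $\boldsymbol x^i$ be $\boldsymbol x$ with the $i$th component replaced by $1-x_i$. The spin system on ${\bf Z}$ with parameter vector $(p_0,p_1,p_2,p_3)$ is the Feller process in $\{0,1\}^{\bf Z}$ whose generator is the closure of $(\mathscr{L}f)(\boldsymbol x)=\sum_{i\in{\bf Z}}c_i(\boldsymbol x)[f(\boldsymbol x^i)-f(\boldsymbol x)]$ acting on functions $f$ depending on only finitely many components, with $c_i(\boldsymbol x)=p_{m_i(\boldsymbol x)}$ if $x_i=0$ and $c_i(\boldsymbol x)=q_{m_i(\boldsymbol x)}$ if $x_i=1$. It is ergodic if it has a unique stationary distribution $\pi$ and, for every initial distribution, the process at time $t$ converges in distribution to $\pi$ as $t\to\infty$. The initial distribution of the process in the claim is arbitrary. Profits: the process is realized so that each player $i\in{\bf Z}$ plays at the times of a rate 1 Poisson process, independent over players; when player $i$ plays and the state just before is $\boldsymbol x$, he wins one unit (his status $x_i$ becomes 1) with probability $p_{m_i(\boldsymbol x)}$ and loses one unit (his status becomes 0) with probability $q_{m_i(\boldsymbol x)}$. Plays that do not change the player's status also count. $\hat S_t$ is the number of wins minus the number of losses of player $0$ up to time $t$. $\pi_{i,j}(u,v):=\pi\{\boldsymbol x:x_i=u,x_j=v\}$ and $\pi_i(u):=\pi\{\boldsymbol x:x_i=u\}$. *)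

theory Defs
  imports "HOL-Probability.Probability"
begin

text \<open>A configuration is a point of the compact product space \<open>{0,1}\<^sup>\<int>\<close>: \<open>bool\<close> carries the
  discrete topology and \<^term>\<open>True\<close> stands for 1.\<close>

type_synonym config = "int \<Rightarrow> bool"

definition status :: "config \<Rightarrow> int \<Rightarrow> nat" where
  "status x i = of_bool (x i)"

definition nbhd :: "int \<Rightarrow> config \<Rightarrow> nat" where
  "nbhd i x = 2 * status x (i - 1) + status x (i + 1)"

definition flip :: "int \<Rightarrow> config \<Rightarrow> config" where
  "flip i x = x(i := \<not> x i)"

definition flip_rate :: "(nat \<Rightarrow> real) \<Rightarrow> int \<Rightarrow> config \<Rightarrow> real" where
  "flip_rate p i x = (if x i then 1 - p (nbhd i x) else p (nbhd i x))"

definition local_function :: "(config \<Rightarrow> real) \<Rightarrow> bool" where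
  "local_function f \<longleftrightarrow> (\<exists>A. finite A \<and> (\<forall>x y. (\<forall>i\<in>A. x i = y i) \<longrightarrow> f x = f y))"

text \<open>Unbounded operators on the Banach space of continuous functions (with the supremum norm) are
  represented by their graphs, so that the closure of an operator is the closure of its graph.
  The infinite sum below has only finitely many nonzero terms.\<close>

definition spin_pregenerator :: "(nat \<Rightarrow> real) \<Rightarrow> ((config \<Rightarrow>\<^sub>C real) \<times> (config \<Rightarrow>\<^sub>C real)) set" where
  "spin_pregenerator p =
    {(f, g). local_function (apply_bcontfun f) \<and>
       (\<forall>x. apply_bcontfun g x =
          (\<Sum>\<^sub>\<infinity>i\<in>UNIV. flip_rate p i x * (apply_bcontfun f (flip i x) - apply_bcontfun f x)))}"

definition semigroup_op ::
  "(real \<Rightarrow> config \<Rightarrow> config measure) \<Rightarrow> real \<Rightarrow> (config \<Rightarrow>\<^sub>C real) \<Rightarrow> (config \<Rightarrow>\<^sub>C real)" where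
  "semigroup_op K t f = Bcontfun (\<lambda>x. LINT y|K t x. f y)"

definition generator ::
  "(real \<Rightarrow> config \<Rightarrow> config measure) \<Rightarrow> ((config \<Rightarrow>\<^sub>C real) \<times> (config \<Rightarrow>\<^sub>C real)) set" where
  "generator K = {(f, g). ((\<lambda>t. (1 / t) *\<^sub>R (semigroup_op K t f - f)) \<longlongrightarrow> g) (at_right 0)}"

text \<open>Transition functions of Feller processes; only times \<open>t \<ge> 0\<close> are constrained.\<close>

locale feller_transition =
  fixes K :: "real \<Rightarrow> config \<Rightarrow> config measure"
  assumes kernel: "0 \<le> t \<Longrightarrow> K t \<in> borel \<rightarrow>\<^sub>M prob_algebra borel"
    and start: "K 0 x = return borel x"
    and Chapman_Kolmogorov: "0 \<le> s \<Longrightarrow> 0 \<le> t \<Longrightarrow> K (s + t) x = bind (K s x) (K t)"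
    and feller: "0 \<le> t \<Longrightarrow> continuous_on UNIV (\<lambda>x. LINT y|K t x. apply_bcontfun f y)"
    and strongly_continuous: "((\<lambda>t. semigroup_op K t f) \<longlongrightarrow> f) (at_right 0)"

definition spin_system :: "(nat \<Rightarrow> real) \<Rightarrow> (real \<Rightarrow> config \<Rightarrow> config measure) \<Rightarrow> bool" where
  "spin_system p K \<longleftrightarrow> feller_transition K \<and> generator K = closure (spin_pregenerator p)"

definition config_distribution :: "config measure \<Rightarrow> bool" where
  "config_distribution \<nu> \<longleftrightarrow> prob_space \<nu> \<and> sets \<nu> = sets borel"

definition stationary :: "(real \<Rightarrow> config \<Rightarrow> config measure) \<Rightarrow> config measure \<Rightarrow> bool" where
  "stationary K \<nu> \<longleftrightarrow> config_distribution \<nu> \<and> (\<forall>t\<ge>0. bind \<nu> (K t) = \<nu>)"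

definition ergodic :: "(real \<Rightarrow> config \<Rightarrow> config measure) \<Rightarrow> config measure \<Rightarrow> bool" where
  "ergodic K \<pi> \<longleftrightarrow>
     stationary K \<pi> \<and> (\<forall>\<nu>. stationary K \<nu> \<longrightarrow> \<nu> = \<pi>) \<and>
     (\<forall>\<nu>. config_distribution \<nu> \<longrightarrow>
       (\<forall>f :: config \<Rightarrow>\<^sub>C real. ((\<lambda>t. LINT x|bind \<nu> (K t). f x) \<longlongrightarrow> (LINT x|\<pi>. f x)) at_top))"

definition marginal1 :: "config measure \<Rightarrow> int \<Rightarrow> nat \<Rightarrow> real" where
  "marginal1 \<pi> i u = measure \<pi> {x. status x i = u}"

definition marginal2 :: "config measure \<Rightarrow> int \<Rightarrow> int \<Rightarrow> nat \<Rightarrow> nat \<Rightarrow> real" where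
  "marginal2 \<pi> i j u v = measure \<pi> {x. status x i = u \<and> status x j = v}"

text \<open>\<open>T i n\<close> is the time of the \<open>n\<close>-th play (counted from 0) of player \<open>i\<close>.\<close>

definition num_plays :: "(int \<Rightarrow> nat \<Rightarrow> 'w \<Rightarrow> real) \<Rightarrow> int \<Rightarrow> real \<Rightarrow> 'w \<Rightarrow> nat" where
  "num_plays T i t \<omega> = card {n. T i n \<omega> \<le> t}"

text \<open>The configuration just before time \<open>t\<close>, as a left limit in each coordinate.\<close>

definition state_before :: "(real \<Rightarrow> 'w \<Rightarrow> config) \<Rightarrow> real \<Rightarrow> 'w \<Rightarrow> config" where
  "state_before X t \<omega> = (\<lambda>j. Lim (at_left t) (\<lambda>s. X s \<omega> j))"

text \<open>The \<open>\<sigma>\<close>-algebra \<open>F\<^bsub>\<tau>-\<^esub>\<close> of events strictly before the random time \<open>\<tau>\<close>.\<close>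

definition strict_past ::
  "'w measure \<Rightarrow> (real \<Rightarrow> 'w measure) \<Rightarrow> ('w \<Rightarrow> real) \<Rightarrow> 'w measure" where
  "strict_past M F \<tau> =
     sigma (space M) (sets (F 0) \<union> {A \<inter> {\<omega> \<in> space M. t < \<tau> \<omega>} |A t. 0 \<le> t \<and> A \<in> sets (F t)})"

text \<open>The spin system \<open>X\<close> together with the plays of all players, adapted to a filtration \<open>F\<close>.
  The law of \<open>X 0\<close> is arbitrary. The assumptions \<open>plays_Poisson\<close> and \<open>plays_indep\<close> together say that
  the play counts form independent rate 1 Poisson processes (and are Poisson relative to \<open>F\<close>):
  for \<open>s < t\<close> the numbers of plays of the various players in \<open>{s<..t}\<close> and the past \<open>F s\<close> are
  mutually independent, where \<^term>\<open>None\<close> indexes the past and \<^term>\<open>Some i\<close> player \<open>i\<close>. A play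
  of player \<open>i\<close> at time \<open>\<tau>\<close> is a win if and only if his status at time \<open>\<tau>\<close> is 1.\<close>

locale spin_play = prob_space M + filtration "space M" F
  for M :: "'w measure" and F :: "real \<Rightarrow> 'w measure" +
  fixes p :: "nat \<Rightarrow> real"
    and K :: "real \<Rightarrow> config \<Rightarrow> config measure"
    and X :: "real \<Rightarrow> 'w \<Rightarrow> config"
    and T :: "int \<Rightarrow> nat \<Rightarrow> 'w \<Rightarrow> real"
  assumes filtration_sub: "subalgebra M (F t)"
    and adapted: "0 \<le> t \<Longrightarrow> X t \<in> F t \<rightarrow>\<^sub>M borel"
    and markov: "0 \<le> s \<Longrightarrow> 0 \<le> t \<Longrightarrow>
      AE \<omega> in M. real_cond_exp M (F s) (\<lambda>\<omega>'. apply_bcontfun f (X (s + t) \<omega>')) \<omega>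
        = (LINT y|K t (X s \<omega>). apply_bcontfun f y)"
    and play_stopping_time: "stopping_time F (T i n)"
    and play_times: "\<omega> \<in> space M \<Longrightarrow> 0 < T i 0 \<omega>"
      "\<omega> \<in> space M \<Longrightarrow> strict_mono (\<lambda>n. T i n \<omega>)"
      "\<omega> \<in> space M \<Longrightarrow> filterlim (\<lambda>n. T i n \<omega>) at_top sequentially"
    and plays_Poisson: "0 \<le> s \<Longrightarrow> s < t \<Longrightarrow>
      distr M (count_space UNIV) (\<lambda>\<omega>. num_plays T i t \<omega> - num_plays T i s \<omega>)
        = measure_pmf (poisson_pmf (t - s))"
    and plays_indep: "0 \<le> s \<Longrightarrow> s < t \<Longrightarrow>
      indep_sets (\<lambda>j. case j of None \<Rightarrow> sets (F s)
        | Some i \<Rightarrow> sets (vimage_algebra (space M)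
            (\<lambda>\<omega>. num_plays T i t \<omega> - num_plays T i s \<omega>) (count_space UNIV))) UNIV"
    and constant_between_plays: "\<omega> \<in> space M \<Longrightarrow> 0 \<le> s \<Longrightarrow> s \<le> t \<Longrightarrow>
      (\<And>n. T i n \<omega> \<notin> {s<..t}) \<Longrightarrow> X t \<omega> i = X s \<omega> i"
    and win_probability:
      "AE \<omega> in M. real_cond_exp M (strict_past M F (T i n))
          (indicator {\<omega>' \<in> space M. X (T i n \<omega>') \<omega>' i}) \<omega>
        = p (nbhd i (state_before X (T i n \<omega>) \<omega>))"

definition profit ::
  "(real \<Rightarrow> 'w \<Rightarrow> config) \<Rightarrow> (int \<Rightarrow> nat \<Rightarrow> 'w \<Rightarrow> real) \<Rightarrow> int \<Rightarrow> real \<Rightarrow> 'w \<Rightarrow> real" where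
  "profit X T i t \<omega> =
     real (card {n. T i n \<omega> \<le> t \<and> X (T i n \<omega>) \<omega> i}) -
     real (card {n. T i n \<omega> \<le> t \<and> \<not> X (T i n \<omega>) \<omega> i})"

end

theory Submission
  imports Defs
begin

text \<open>The profit after \<open>n\<close> plays is a sum of wins and losses. Relative to the strict past, the
  win of a play minus its conditional probability \<open>p\<^bsub>m\<^esub>\<close> is an orthogonal sequence, so it averages
  to 0, and it remains to average the probabilities seen at the plays. Cut time into intervals of
  length \<open>\<delta>\<close>: unless a neighbour plays too, all plays of player 0 in an interval see the
  neighbourhood at its start, and the number of plays is independent of the past with mean \<open>\<delta>\<close>.
  So up to an error of relative size \<open>2\<delta>\<close> one averages \<open>p\<^bsub>m\<^esub>\<close> along the Markov chain
  \<open>X\<^bsub>k\<delta>\<^esub>\<close>. Such averages converge to the \<open>\<pi>\<close>-mean from every initial law, since the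
  Cesaro means of the transition operators converge uniformly (compactness and ergodicity).

  The shift of \<open>\<pi>\<close> is again stationary because the generator commutes with shifts, so \<open>\<pi>\<close> is
  shift invariant by uniqueness. Applying the generator to the status of player 0 shows that the
  \<open>\<pi>\<close>-mean of \<open>p\<^bsub>m\<^esub>\<close> is \<open>\<pi>\<^sub>0(1)\<close>.\<close>

section \<open>Configurations\<close>

text \<open>Ergodicity gives weak convergence for each initial law separately, while a pathwise
  average needs control from wherever the path happens to be; this gap is why the Cesaro means must
  converge uniformly. The other obstacle is that player 0 samples his neighbourhood at random times,
  whereas the hypotheses describe play counts over deterministic intervals; the grid mediates
  between the two. On an interval of length \<delta> the product of the counts of player 0 and one
  neighbour has mean \<open>\<delta>\<^sup>2\<close>. The two neighbours cost
  \<open>2 * \<delta>\<^sup>2\<close> per interval, and the averaged fluctuations are eventually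
  below another \<open>\<delta>\<^sup>2\<close>; this is the origin of
  \<open>3 * \<delta>\<^sup>2\<close>. Relative to the interval length the error is
  \<open>3 * \<delta>\<close>, and the meshes \<open>1 / real (Suc r)\<close> let it vanish with
  only countably many null sets. Every almost sure limit along the grid or along the plays goes back
  to one law for orthogonal sequences with bounded second moments, which asks for neither
  independence nor equal laws.\<close>

instance bool :: second_countable_topology
proof
  have "(open :: bool set \<Rightarrow> bool) = generate_topology UNIV"
    by (rule ext) (simp add: discrete_topology_class.open_discrete generate_topology.Basis)
  then show "\<exists>B :: bool set set. countable B \<and> open = generate_topology B"
    by (intro exI[of _ UNIV]) (simp add: countable_finite)
qed

text \<open>Naming the coordinate set and leaving the value type free lets one notion serve local
  functions, cylinder sets (as predicates) and flip rates.\<close>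

definition depends_on :: "int set \<Rightarrow> (config \<Rightarrow> 'b) \<Rightarrow> bool" where
  "depends_on J f \<longleftrightarrow> (\<forall>x y. (\<forall>i\<in>J. x i = y i) \<longrightarrow> f x = f y)"

lemma depends_onD: "depends_on J f \<Longrightarrow> (\<And>i. i \<in> J \<Longrightarrow> x i = y i) \<Longrightarrow> f x = f y"
  unfolding depends_on_def by blast

lemma local_function_iff: "local_function f \<longleftrightarrow> (\<exists>J. finite J \<and> depends_on J f)"
  by (simp add: local_function_def depends_on_def)

lemma compact_config: "compact (UNIV :: config set)"
proof -
  have "compact_space (euclidean :: bool topology)"
    by (simp add: compact_space_def finite_imp_compact)
  then have "compact_space (product_topology (\<lambda>_::int. euclidean :: bool topology) UNIV)"
    by (simp add: compact_space_product_topology)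
  then show ?thesis
    by (simp add: euclidean_product_topology compact_space_def)
qed

lemma open_cylinder: "finite J \<Longrightarrow> open {y :: config. \<forall>i\<in>J. y i = x i}"
proof -
  assume J: "finite J"
  have "open (\<Inter>i\<in>J. (\<lambda>y :: config. y i) -` {x i})"
    by (intro open_INT J ballI open_vimage discrete_topology_class.open_discrete continuous_on_product_coordinates)
  also have "(\<Inter>i\<in>J. (\<lambda>y :: config. y i) -` {x i}) = {y. \<forall>i\<in>J. y i = x i}"
    by auto
  finally show ?thesis .
qed

text \<open>Fixing the coordinates in J describes an open set on which f is constant, so f is
  locally constant.\<close>

lemma depends_on_continuous:
  fixes f :: "config \<Rightarrow> 'b::topological_space"
  assumes "finite J" "depends_on J f"
  shows "continuous_on UNIV f"
proof -
  have "open (f -` B)" for B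
  proof (subst open_subopen, intro ballI)
    fix x assume x: "x \<in> f -` B"
    have "{y. \<forall>i\<in>J. y i = x i} \<subseteq> f -` B"
    proof
      fix y assume "y \<in> {y. \<forall>i\<in>J. y i = x i}"
      then have "f y = f x" by (intro depends_onD[OF assms(2)]) simp
      then show "y \<in> f -` B" using x by simp
    qed
    then show "\<exists>C. open C \<and> x \<in> C \<and> C \<subseteq> f -` B"
      using open_cylinder[OF assms(1)] by blast
  qed
  then show ?thesis
    by (simp add: continuous_on_open_vimage)
qed

lemma continuous_config_bcontfun:
  assumes "continuous_on UNIV (f :: config \<Rightarrow> real)"
  shows "f \<in> bcontfun"
  using compact_imp_bounded[OF compact_continuous_image[OF assms compact_config]] assms
  by (simp add: bcontfun_def)

lemma apply_Bcontfun_config [simp]: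
  "continuous_on UNIV (f :: config \<Rightarrow> real) \<Longrightarrow> apply_bcontfun (Bcontfun f) = f"
  by (rule Bcontfun_inverse) (rule continuous_config_bcontfun)

text \<open>Every value is already taken at a configuration that vanishes outside J, and there are
  only finitely many of these.\<close>

lemma finite_range_local:
  assumes "finite J" "depends_on J f"
  shows "finite (range f)"
proof (rule finite_subset)
  show "range f \<subseteq> (\<lambda>S. f (\<lambda>i. i \<in> S)) ` Pow J"
  proof
    fix v assume "v \<in> range f"
    then obtain x where "v = f x" by blast
    also have "f x = f (\<lambda>i. i \<in> {i \<in> J. x i})"
      by (rule depends_onD[OF assms(2)]) simp
    finally show "v \<in> (\<lambda>S. f (\<lambda>i. i \<in> S)) ` Pow J" by blast
  qed
qed (use assms(1) in simp)

definition cylinders :: "config set set" where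
  "cylinders = {A. \<exists>J. finite J \<and> depends_on J (\<lambda>x. x \<in> A)}"

lemma open_imp_local_nbhd:
  assumes "open U" "(x :: config) \<in> U"
  obtains J where "finite J" "\<And>y. (\<forall>i\<in>J. y i = x i) \<Longrightarrow> y \<in> U"
proof -
  have "openin (product_topology (\<lambda>_. euclidean) UNIV) U"
    using assms(1) by (simp add: euclidean_product_topology)
  from product_topology_open_contains_basis[OF this assms(2)] obtain V where
    V: "x \<in> (\<Pi>\<^sub>E i\<in>UNIV. V i)" "finite {i. V i \<noteq> UNIV}" "(\<Pi>\<^sub>E i\<in>UNIV. V i) \<subseteq> U"
    by auto
  show ?thesis
  proof (rule that[of "{i. V i \<noteq> UNIV}"])
    fix y assume y: "\<forall>i\<in>{i. V i \<noteq> UNIV}. y i = x i"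
    have "y i \<in> V i" for i
      using y V(1) by (cases "V i = UNIV") (auto simp: PiE_iff)
    then have "y \<in> (\<Pi>\<^sub>E i\<in>UNIV. V i)"
      by (simp add: PiE_iff)
    then show "y \<in> U" using V(3) by blast
  qed (rule V(2))
qed

text \<open>By compactness finitely many cylinder neighbourhoods, on each of which f stays within
  \<open>e / 2\<close> of its value at the centre, cover the space. Erasing all coordinates outside
  the finite set J that they involve keeps a configuration in its neighbourhood, so f of the
  truncated configuration is the approximant.\<close>

lemma local_approximation:
  assumes "continuous_on UNIV (f :: config \<Rightarrow> real)" "0 < e"
  obtains J g where "finite J" "depends_on J g" "\<And>x. \<bar>f x - g x\<bar> < e"
proof -
  have "\<exists>J. finite J \<and> (\<forall>y. (\<forall>i\<in>J. y i = x i) \<longrightarrow> \<bar>f y - f x\<bar> < e / 2)" for x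
  proof -
    have "open (f -` {f x - e / 2 <..< f x + e / 2})"
      using assms(1) by (simp add: continuous_on_open_vimage)
    moreover have "x \<in> f -` {f x - e / 2 <..< f x + e / 2}"
      using assms(2) by simp
    ultimately obtain J where J: "finite J"
      "\<And>y. (\<forall>i\<in>J. y i = x i) \<Longrightarrow> y \<in> f -` {f x - e / 2 <..< f x + e / 2}"
      by (rule open_imp_local_nbhd) blast
    have "\<bar>f y - f x\<bar> < e / 2" if "\<forall>i\<in>J. y i = x i" for y
      using J(2)[OF that] unfolding vimage_eq greaterThanLessThan_iff by linarith
    then show ?thesis using J(1) by blast
  qed
  then obtain N where N: "\<And>x. finite (N x)"
    "\<And>x y. (\<forall>i\<in>N x. y i = x i) \<Longrightarrow> \<bar>f y - f x\<bar> < e / 2"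
    by metis
  have "UNIV \<subseteq> (\<Union>x\<in>UNIV. {y :: config. \<forall>i\<in>N x. y i = x i})" by blast
  moreover have "open {y :: config. \<forall>i\<in>N x. y i = x i}" for x
    by (rule open_cylinder[OF N(1)])
  ultimately obtain S where S: "finite S" "UNIV \<subseteq> (\<Union>x\<in>S. {y :: config. \<forall>i\<in>N x. y i = x i})"
    by (meson compactE_image[OF compact_config])
  let ?J = "\<Union>x\<in>S. N x"
  show ?thesis
  proof (rule that[of ?J "\<lambda>y. f (\<lambda>i. i \<in> ?J \<and> y i)"])
    show "finite ?J" using S(1) N(1) by blast
    show "depends_on ?J (\<lambda>y. f (\<lambda>i. i \<in> ?J \<and> y i))"
      unfolding depends_on_def by (auto intro!: arg_cong[where f = f])
    fix y
    obtain x where x: "x \<in> S" "\<forall>i\<in>N x. y i = x i" using S(2) by blast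
    have "\<bar>f y - f x\<bar> < e / 2" by (rule N(2)[OF x(2)])
    moreover have "\<bar>f (\<lambda>i. i \<in> ?J \<and> y i) - f x\<bar> < e / 2"
      by (rule N(2)) (use x in blast)
    ultimately show "\<bar>f y - f (\<lambda>i. i \<in> ?J \<and> y i)\<bar> < e" by linarith
  qed
qed

section \<open>Cylinders as a generating algebra, and measures from positive functionals\<close>

lemma cylinders_open: "A \<in> cylinders \<Longrightarrow> open A"
proof -
  assume "A \<in> cylinders"
  then obtain J where "finite J" "depends_on J (\<lambda>x. x \<in> A)" by (auto simp: cylinders_def)
  from depends_on_continuous[OF this] have "open ((\<lambda>x. x \<in> A) -` {True})"
    by (intro open_vimage discrete_topology_class.open_discrete)
  then show ?thesis by (simp add: vimage_def)
qed

lemma algebra_cylinders: "algebra UNIV cylinders"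
  unfolding algebra_iff_Un
proof (intro conjI ballI)
  show "{} \<in> cylinders" by (auto simp: cylinders_def depends_on_def)
  fix A assume "A \<in> cylinders"
  then obtain J where J: "finite J" "depends_on J (\<lambda>x. x \<in> A)" by (auto simp: cylinders_def)
  then show "UNIV - A \<in> cylinders" by (auto simp: cylinders_def depends_on_def)
  fix B assume "B \<in> cylinders"
  then obtain J' where J': "finite J'" "depends_on J' (\<lambda>x. x \<in> B)" by (auto simp: cylinders_def)
  have "depends_on (J \<union> J') (\<lambda>x. x \<in> A \<union> B)"
    using J(2) J'(2) unfolding depends_on_def by blast
  then show "A \<union> B \<in> cylinders" using J(1) J'(1) unfolding cylinders_def by blast
qed auto

lemma sigma_sets_cylinders: "sigma_sets UNIV cylinders = sets (borel :: config measure)"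
proof
  show "sigma_sets UNIV cylinders \<subseteq> sets (borel :: config measure)"
    by (rule sets.sigma_sets_subset[of cylinders borel, simplified]) (auto dest: cylinders_open)
  \<comment> \<open>Second countability of \<open>bool\<close> enters here: it makes the Borel sets
    of the countable product the product sigma-algebra.\<close>
  have eq: "sets (borel :: config measure) =
      sigma_sets UNIV {{f. f i \<in> A} |i A. A \<in> sets (borel :: bool measure)}"
    using sets_PiM_single[of UNIV "\<lambda>_::int. borel :: bool measure", unfolded sets_PiM_equal_borel]
    by simp
  show "sets (borel :: config measure) \<subseteq> sigma_sets UNIV cylinders"
    unfolding eq
  proof (rule sigma_sets_mono')
    show "{{f. f i \<in> A} |i A. A \<in> sets (borel :: bool measure)} \<subseteq> cylinders"
    proof safe
      fix i and A :: "bool set"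
      show "{f. f i \<in> A} \<in> cylinders"
        unfolding cylinders_def depends_on_def by (intro CollectI exI[of _ "{i}"]) auto
    qed
  qed
qed

lemma cylinders_Int_stable: "Int_stable cylinders"
  using algebra_cylinders unfolding algebra_iff_Int Int_stable_def by blast

lemma config_distribution_eqI:
  assumes "config_distribution \<mu>" "config_distribution \<nu>"
    and "\<And>A. A \<in> cylinders \<Longrightarrow> measure \<mu> A = measure \<nu> A"
  shows "\<mu> = \<nu>"
proof (rule measure_eqI_generator_eq[OF cylinders_Int_stable])
  interpret \<mu>: prob_space \<mu> using assms by (simp add: config_distribution_def)
  interpret \<nu>: prob_space \<nu> using assms by (simp add: config_distribution_def)
  show "cylinders \<subseteq> Pow UNIV" by simp
  show "emeasure \<mu> A = emeasure \<nu> A" if "A \<in> cylinders" for A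
    using assms(3)[OF that] by (simp add: \<mu>.emeasure_eq_measure \<nu>.emeasure_eq_measure)
  show "sets \<mu> = sigma_sets UNIV cylinders" "sets \<nu> = sigma_sets UNIV cylinders"
    using assms by (simp_all add: config_distribution_def sigma_sets_cylinders)
  show "range (\<lambda>_::nat. UNIV) \<subseteq> cylinders"
    by (auto simp: cylinders_def depends_on_def)
  show "emeasure \<mu> UNIV \<noteq> \<infinity>"
    using \<mu>.emeasure_finite by simp
qed simp

lemma config_distributionD:
  assumes "config_distribution \<nu>"
  shows "prob_space \<nu>" "sets \<nu> = sets borel" "space \<nu> = UNIV"
  using assms sets_eq_imp_space_eq[of \<nu> borel] by (auto simp: config_distribution_def)

lemma integrable_config:
  assumes "config_distribution \<nu>" "continuous_on UNIV (f :: config \<Rightarrow> real)"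
  shows "integrable \<nu> f"
proof -
  interpret prob_space \<nu> using config_distributionD[OF assms(1)] by simp
  have "bounded (range f)" using continuous_config_bcontfun[OF assms(2)] by (simp add: bcontfun_def)
  then obtain B where B: "\<And>x. norm (f x) \<le> B" unfolding bounded_iff by blast
  have "f \<in> borel_measurable \<nu>"
    using borel_measurable_continuous_onI[OF assms(2)]
    by (simp add: measurable_cong_sets[OF config_distributionD(2)[OF assms(1)] refl])
  then show ?thesis
    using B by (intro integrable_const_bound[where B = B]) auto
qed

text \<open>By compactness, a union of countably many disjoint cylinders is a cylinder only if almost
  all of them are empty, so that countable additivity is for free.\<close>

lemma Riesz_config:
  fixes \<Lambda> :: "(config \<Rightarrow> real) \<Rightarrow> real"
  assumes add: "\<And>f g. continuous_on UNIV f \<Longrightarrow> continuous_on UNIV g \<Longrightarrow>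
      \<Lambda> (\<lambda>x. f x + g x) = \<Lambda> f + \<Lambda> g"
    and scale: "\<And>c f. continuous_on UNIV f \<Longrightarrow> \<Lambda> (\<lambda>x. c * f x) = c * \<Lambda> f"
    and pos: "\<And>f. continuous_on UNIV f \<Longrightarrow> (\<And>x. 0 \<le> f x) \<Longrightarrow> 0 \<le> \<Lambda> f"
    and one: "\<Lambda> (\<lambda>x. 1) = 1"
  obtains \<nu> where "config_distribution \<nu>"
    "\<And>f. continuous_on UNIV f \<Longrightarrow> \<Lambda> f = (LINT x|\<nu>. f x)"
proof -
  interpret algebra "UNIV :: config set" cylinders by (rule algebra_cylinders)
  have cont_ind: "continuous_on UNIV (indicator A :: config \<Rightarrow> real)" if A: "A \<in> cylinders" for A
  proof -
    obtain J where J: "finite J" "depends_on J (\<lambda>x. x \<in> A)" using A by (auto simp: cylinders_def)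
    have "depends_on J (indicator A :: config \<Rightarrow> real)"
      using J(2) by (auto simp: depends_on_def indicator_def)
    then show ?thesis by (rule depends_on_continuous[OF J(1)])
  qed
  \<comment> \<open>Cylinders are clopen, so their indicators are continuous and the functional can
    be evaluated on them directly.\<close>
  define \<mu> where "\<mu> A = \<Lambda> (indicator A)" for A
  have \<mu>_nonneg: "0 \<le> \<mu> A" if "A \<in> cylinders" for A
    unfolding \<mu>_def by (rule pos[OF cont_ind[OF that]]) simp
  have \<Lambda>_zero: "\<Lambda> (\<lambda>x. 0) = 0"
    using scale[of "\<lambda>_. 1" 0] by simp
  have \<mu>_empty: "\<mu> {} = 0"
    using \<Lambda>_zero by (simp add: \<mu>_def indicator_def[abs_def])
  have \<mu>_Un: "\<mu> (A \<union> B) = \<mu> A + \<mu> B" if "A \<in> cylinders" "B \<in> cylinders" "A \<inter> B = {}" for A B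
  proof -
    have "(indicator (A \<union> B) :: config \<Rightarrow> real) = (\<lambda>x. indicator A x + indicator B x)"
      using that(3) by (auto simp: indicator_def fun_eq_iff)
    then show ?thesis
      unfolding \<mu>_def using add[OF cont_ind[OF that(1)] cont_ind[OF that(2)]] by simp
  qed
  have add_ennreal: "additive cylinders (\<lambda>A. ennreal (\<mu> A))"
    by (simp add: additive_def \<mu>_Un \<mu>_nonneg ennreal_plus)
  have positive: "positive cylinders (\<lambda>A. ennreal (\<mu> A))"
    by (simp add: positive_def \<mu>_empty)
  have "countably_additive cylinders (\<lambda>A. ennreal (\<mu> A))"
  proof (rule countably_additiveI)
    fix A :: "nat \<Rightarrow> config set"
    assume A: "range A \<subseteq> cylinders" "disjoint_family A" "(\<Union>i. A i) \<in> cylinders"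
    have "closed (\<Union>i. A i)"
      using cylinders_open[OF compl_sets[OF A(3)]] unfolding closed_def Compl_eq_Diff_UNIV .
    then have "compact (\<Union>i. A i)"
      using compact_Int_closed[OF compact_config, of "\<Union>i. A i"] by simp
    moreover have "open (A i)" for i using A(1) cylinders_open by blast
    ultimately obtain S where S: "finite S" "(\<Union>i. A i) \<subseteq> (\<Union>i\<in>S. A i)"
      by (meson compactE_image order_refl)
    have empty: "A i = {}" if "i \<notin> S" for i
    proof -
      have "A i \<inter> A j = {}" if "j \<in> S" for j
        using A(2) that \<open>i \<notin> S\<close> unfolding disjoint_family_on_def by (metis UNIV_I)
      then show ?thesis using S(2) by blast
    qed
    have "(\<Sum>i. ennreal (\<mu> (A i))) = (\<Sum>i\<in>S. ennreal (\<mu> (A i)))"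
      by (rule suminf_finite[OF S(1)]) (simp add: empty \<mu>_empty)
    also have "\<dots> = ennreal (\<mu> (\<Union>i\<in>S. A i))"
      by (rule additive_sum[OF positive add_ennreal S(1)])
        (use A in \<open>auto simp: disjoint_family_on_def\<close>)
    also have "(\<Union>i\<in>S. A i) = (\<Union>i. A i)" using S(2) by blast
    finally show "(\<Sum>i. ennreal (\<mu> (A i))) = ennreal (\<mu> (\<Union>i. A i))" .
  qed
  from caratheodory'[OF positive this] obtain m where
    m: "\<And>A. A \<in> cylinders \<Longrightarrow> m A = ennreal (\<mu> A)" "measure_space UNIV (sigma_sets UNIV cylinders) m"
    by blast
  define \<nu> where "\<nu> = measure_of UNIV (sigma_sets UNIV cylinders) m"
  have sets_\<nu>: "sets \<nu> = sigma_sets UNIV cylinders"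
    unfolding \<nu>_def by (simp add: sets_measure_of_conv sigma_sets_sigma_sets_eq)
  have emeasure_\<nu>: "emeasure \<nu> A = ennreal (\<mu> A)" if "A \<in> cylinders" for A
  proof -
    have "emeasure \<nu> A = m A"
      using m(2) that
      by (intro emeasure_measure_of[OF \<nu>_def])
        (auto simp: sets_\<nu> measure_space_def)
    then show ?thesis using m(1)[OF that] by simp
  qed
  have "\<mu> UNIV = 1" using one by (simp add: \<mu>_def indicator_def[abs_def])
  have "prob_space \<nu>"
  proof
    have "space \<nu> = UNIV" by (simp add: \<nu>_def space_measure_of_conv)
    then show "emeasure \<nu> (space \<nu>) = 1"
      using emeasure_\<nu>[OF top] \<open>\<mu> UNIV = 1\<close> by simp
  qed
  then have distribution: "config_distribution \<nu>"
    by (simp add: config_distribution_def sets_\<nu> sigma_sets_cylinders)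
  interpret \<nu>: prob_space \<nu> by fact
  have measure_\<nu>: "measure \<nu> A = \<mu> A" if "A \<in> cylinders" for A
    using emeasure_\<nu>[OF that] \<mu>_nonneg[OF that] by (simp add: measure_def)
  have \<Lambda>_sum: "\<Lambda> (\<lambda>x. \<Sum>v\<in>V. h v x) = (\<Sum>v\<in>V. \<Lambda> (h v)) \<and> continuous_on UNIV (\<lambda>x. \<Sum>v\<in>V. h v x)"
    if "finite V" "\<And>v. v \<in> V \<Longrightarrow> continuous_on UNIV (h v)" for V and h :: "real \<Rightarrow> config \<Rightarrow> real"
    using that
  proof (induction V rule: finite_induct)
    case empty
    then show ?case by (simp add: \<Lambda>_zero)
  next
    case (insert v V)
    have "\<Lambda> (\<lambda>x. h v x + (\<Sum>v\<in>V. h v x)) = \<Lambda> (h v) + \<Lambda> (\<lambda>x. \<Sum>v\<in>V. h v x)"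
      by (rule add) (use insert in auto)
    moreover have "continuous_on UNIV (\<lambda>x. h v x + (\<Sum>v\<in>V. h v x))"
      by (rule continuous_on_add) (use insert in auto)
    ultimately show ?case using insert by simp
  qed
  \<comment> \<open>A local function has finitely many values and its level sets are cylinders, so
    it is a finite combination of indicators.\<close>
  have local: "\<Lambda> g = (LINT x|\<nu>. g x)" if J: "finite J" "depends_on J g" for J g
  proof -
    let ?A = "\<lambda>v. g -` {v}"
    have cyl: "?A v \<in> cylinders" for v
    proof -
      have "depends_on J (\<lambda>x. x \<in> ?A v)"
        unfolding depends_on_def
      proof (intro allI impI)
        fix x y :: config assume "\<forall>i\<in>J. x i = y i"
        then have "g x = g y" using depends_onD[OF J(2), of x y] by blast
        then show "(x \<in> ?A v) = (y \<in> ?A v)" by simp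
      qed
      then show ?thesis using J(1) unfolding cylinders_def by blast
    qed
    have g: "g = (\<lambda>x. \<Sum>v\<in>range g. v * indicator (?A v) x)"
    proof
      fix x
      have "(\<Sum>v\<in>range g. v * indicator (?A v) x) = (\<Sum>v\<in>range g. if g x = v then v else 0)"
        by (rule sum.cong) (auto simp: indicator_def)
      then show "g x = (\<Sum>v\<in>range g. v * indicator (?A v) x)"
        using finite_range_local[OF J] by simp
    qed
    have "\<Lambda> g = \<Lambda> (\<lambda>x. \<Sum>v\<in>range g. v * indicator (?A v) x)"
      by (rule arg_cong[OF g])
    also have "\<dots> = (\<Sum>v\<in>range g. \<Lambda> (\<lambda>x. v * indicator (?A v) x))"
      by (rule conjunct1[OF \<Lambda>_sum[OF finite_range_local[OF J]]])
        (intro continuous_on_mult_left cont_ind cyl)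
    also have "\<dots> = (\<Sum>v\<in>range g. v * measure \<nu> (?A v))"
      by (simp add: scale[OF cont_ind[OF cyl]] measure_\<nu>[OF cyl] \<mu>_def)
    also have "\<dots> = (\<Sum>v\<in>range g. (LINT x|\<nu>. v * indicator (?A v) x))"
      using cyl by (simp add: sets_\<nu> config_distributionD(3)[OF distribution])
    also have "\<dots> = (LINT x|\<nu>. (\<Sum>v\<in>range g. v * indicator (?A v) x))"
      by (rule Bochner_Integration.integral_sum[symmetric])
        (intro integrable_config[OF distribution] continuous_on_mult_left cont_ind cyl)
    also have "\<dots> = (LINT x|\<nu>. g x)"
      by (rule arg_cong[OF g[symmetric]])
    finally show ?thesis .
  qed
  have mono: "\<Lambda> f \<le> \<Lambda> g"
    if "continuous_on UNIV f" "continuous_on UNIV g" "\<And>x. f x \<le> g x" for f g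
  proof -
    have "0 \<le> \<Lambda> (\<lambda>x. g x + (- 1) * f x)"
      by (rule pos) (use that in \<open>auto intro!: continuous_intros\<close>)
    also have "\<dots> = \<Lambda> g + (- 1) * \<Lambda> f"
      using add[OF that(2) continuous_on_mult_left[OF that(1), of "- 1"]] scale[OF that(1), of "- 1"]
      by simp
    finally show ?thesis by simp
  qed
  have representation: "\<Lambda> f = (LINT x|\<nu>. f x)" if f: "continuous_on UNIV f" for f
  proof -
    \<comment> \<open>Continuity of \<Lambda> is not assumed. Positivity carries a uniform
      approximation by a local g through the functional and through the integral, at the price of e
      each time.\<close>
    have bound: "\<bar>\<Lambda> f - (LINT x|\<nu>. f x)\<bar> \<le> 2 * e" if "0 < e" for e
    proof -
      obtain J g where J: "finite J" "depends_on J g" and fg: "\<And>x. \<bar>f x - g x\<bar> < e"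
        by (rule local_approximation[OF f \<open>0 < e\<close>]) blast
      have g: "continuous_on UNIV g" by (rule depends_on_continuous[OF J])
      have const: "\<Lambda> (\<lambda>x. h x + c) = \<Lambda> h + c" if "continuous_on UNIV h" for h c
        using add[of h "\<lambda>_. c * 1"] scale[of "\<lambda>_. 1" c] that one by simp
      have fg': "f x \<le> g x + e" "g x \<le> f x + e" for x
        using fg[of x] by linarith+
      have cont: "continuous_on UNIV (\<lambda>x. g x + e)" "continuous_on UNIV (\<lambda>x. f x + e)"
        by (intro continuous_on_add continuous_on_const f g)+
      have "\<Lambda> f \<le> \<Lambda> (\<lambda>x. g x + e)" "\<Lambda> g \<le> \<Lambda> (\<lambda>x. f x + e)"
        by (rule mono[OF f cont(1) fg'(1)], rule mono[OF g cont(2) fg'(2)])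
      then have 1: "\<bar>\<Lambda> f - \<Lambda> g\<bar> \<le> e"
        unfolding const[OF f] const[OF g] by linarith
      note int = integrable_config[OF distribution]
      have "(LINT x|\<nu>. f x) \<le> (LINT x|\<nu>. g x + e)"
        by (rule integral_mono[OF int[OF f] int[OF cont(1)] fg'(1)])
      also have "\<dots> = (LINT x|\<nu>. g x) + e"
        using int[OF g] by (simp add: \<nu>.prob_space)
      finally have 2: "(LINT x|\<nu>. f x) \<le> (LINT x|\<nu>. g x) + e" .
      have "(LINT x|\<nu>. g x) \<le> (LINT x|\<nu>. f x + e)"
        by (rule integral_mono[OF int[OF g] int[OF cont(2)] fg'(2)])
      also have "\<dots> = (LINT x|\<nu>. f x) + e"
        using int[OF f] by (simp add: \<nu>.prob_space)
      finally show ?thesis using 1 2 local[OF J] by linarith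
    qed
    have "\<bar>\<Lambda> f - (LINT x|\<nu>. f x)\<bar> \<le> 0"
    proof (rule field_le_epsilon)
      fix e :: real assume "0 < e"
      then show "\<bar>\<Lambda> f - (LINT x|\<nu>. f x)\<bar> \<le> 0 + e"
        using bound[of "e / 2"] by simp
    qed
    then show ?thesis by simp
  qed
  show ?thesis by (rule that[OF distribution representation])
qed

text \<open>This is Tychonoff's theorem. The index set will be all continuous functions, so a
  convergent subsequence cannot be expected; a filter finer than \<open>sequentially\<close> takes
  its place, and a single filter for all i lets algebraic relations pass to the limit.\<close>

lemma cluster_point_of_bounded:
  fixes a :: "nat \<Rightarrow> 'i \<Rightarrow> real"
  assumes "\<And>n i. \<bar>a n i\<bar> \<le> B i"
  obtains G l where "G \<noteq> bot" "G \<le> sequentially" "\<And>i. ((\<lambda>n. a n i) \<longlongrightarrow> l i) G"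
proof -
  let ?U = "Pi\<^sub>E UNIV (\<lambda>i. {- B i .. B i})"
  have "compactin (product_topology (\<lambda>_::'i. euclidean :: real topology) UNIV) ?U"
    by (simp add: compactin_PiE)
  then have "compact ?U"
    by (simp add: euclidean_product_topology)
  moreover have "filtermap a sequentially \<noteq> bot"
    by (simp add: filtermap_bot_iff)
  moreover have "eventually (\<lambda>x. x \<in> ?U) (filtermap a sequentially)"
    using assms by (auto simp: eventually_filtermap PiE_iff abs_le_iff minus_le_iff)
  ultimately have "\<exists>l\<in>?U. inf (nhds l) (filtermap a sequentially) \<noteq> bot"
    unfolding compact_filter by simp
  then obtain l where l: "inf (nhds l) (filtermap a sequentially) \<noteq> bot" ..
  \<comment> \<open>The pullback of the neighbourhoods of the cluster point l forces convergence;
    that l is a cluster point is what makes this filter proper.\<close>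
  let ?G = "inf sequentially (filtercomap a (nhds l))"
  show ?thesis
  proof (rule that[of ?G l])
    show "?G \<le> sequentially" by simp
    show "?G \<noteq> bot"
    proof
      assume "?G = bot"
      then have "eventually (\<lambda>_. False) ?G" by simp
      then obtain P Q where PQ: "eventually P sequentially" "eventually Q (filtercomap a (nhds l))"
        "\<And>n. P n \<Longrightarrow> Q n \<Longrightarrow> False"
        unfolding eventually_inf by blast
      then obtain R where R: "eventually R (nhds l)" "\<And>n. R (a n) \<Longrightarrow> Q n"
        unfolding eventually_filtercomap by blast
      have "eventually (\<lambda>x. \<not> R x) (filtermap a sequentially)"
        unfolding eventually_filtermap
        by (rule eventually_mono[OF PQ(1)]) (use PQ(3) R(2) in blast)
      with R(1) have "eventually (\<lambda>_. False) (inf (nhds l) (filtermap a sequentially))"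
        unfolding eventually_inf by (intro exI[of _ R] exI[of _ "\<lambda>x. \<not> R x"]) simp
      then show False using l by (simp add: trivial_limit_def)
    qed
    have "filterlim a (nhds l) ?G"
      unfolding filterlim_def filtermap_le_iff_le_filtercomap by simp
    then have "(a \<longlongrightarrow> l) ?G" .
    from continuous_on_tendsto_compose[OF continuous_on_product_coordinates this UNIV_I]
    show "((\<lambda>n. a n i) \<longlongrightarrow> l i) ?G" for i by simp
  qed
qed

section \<open>Feller transition functions\<close>

lemma config_integral_le_norm:
  fixes f :: "config \<Rightarrow>\<^sub>C real"
  assumes "config_distribution \<nu>"
  shows "\<bar>LINT x|\<nu>. f x\<bar> \<le> norm f"
proof -
  interpret prob_space \<nu> by (rule config_distributionD[OF assms])
  have "\<bar>LINT x|\<nu>. f x\<bar> \<le> (LINT x|\<nu>. \<bar>f x\<bar>)"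
    by (rule integral_abs_bound)
  also have "\<dots> \<le> (LINT x|\<nu>. norm f)"
    by (rule integral_mono)
      (use norm_bounded[of f] in \<open>auto intro!: integrable_config[OF assms] continuous_intros\<close>)
  finally show ?thesis by (simp add: prob_space)
qed

lemma bounded_linear_config_integral:
  assumes "config_distribution \<nu>"
  shows "bounded_linear (\<lambda>f :: config \<Rightarrow>\<^sub>C real. LINT x|\<nu>. f x)"
proof (rule bounded_linear_intro[where K = 1])
  have int: "integrable \<nu> (apply_bcontfun f)" for f :: "config \<Rightarrow>\<^sub>C real"
    by (rule integrable_config[OF assms]) simp
  show "(LINT x|\<nu>. apply_bcontfun (f + g) x) = (LINT x|\<nu>. apply_bcontfun f x) + (LINT x|\<nu>. apply_bcontfun g x)" for f g :: "config \<Rightarrow>\<^sub>C real"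
    using Bochner_Integration.integral_add[OF int int, of f g] by simp
  show "(LINT x|\<nu>. apply_bcontfun (c *\<^sub>R f) x) = c *\<^sub>R (LINT x|\<nu>. apply_bcontfun f x)"
    for c and f :: "config \<Rightarrow>\<^sub>C real"
    by simp
  show "norm (LINT x|\<nu>. apply_bcontfun f x) \<le> norm f * 1" for f :: "config \<Rightarrow>\<^sub>C real"
    using config_integral_le_norm[OF assms] by simp
qed

context feller_transition
begin

lemma kernel_distribution: "0 \<le> t \<Longrightarrow> config_distribution (K t x)"
  using measurable_space[OF kernel, of t x]
  by (simp add: space_prob_algebra config_distribution_def)

lemma continuous_transition:
  assumes "0 \<le> t" "continuous_on UNIV (f :: config \<Rightarrow> real)"
  shows "continuous_on UNIV (\<lambda>x. LINT y|K t x. f y)"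
  using feller[OF assms(1), of "Bcontfun f"] assms(2) by simp

lemma apply_semigroup_op [simp]:
  "0 \<le> t \<Longrightarrow> apply_bcontfun (semigroup_op K t f) = (\<lambda>x. LINT y|K t x. f y)"
  unfolding semigroup_op_def using feller by simp

lemma distribution_bind:
  assumes "config_distribution \<nu>" "0 \<le> t"
  shows "config_distribution (bind \<nu> (K t))"
proof -
  note [measurable_cong] = config_distributionD(2)[OF assms(1)]
  have "\<nu> \<in> space (prob_algebra \<nu>)"
    using assms(1) by (simp add: space_prob_algebra config_distribution_def)
  moreover have "K t \<in> \<nu> \<rightarrow>\<^sub>M prob_algebra borel"
    using kernel[OF assms(2)] by measurable
  ultimately show ?thesis
    using prob_space_bind'[of \<nu> \<nu> "K t" borel] sets_bind'[of \<nu> \<nu> "K t" borel]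
    by (simp add: config_distribution_def)
qed

lemma integral_bind_transition:
  assumes "config_distribution \<nu>" "0 \<le> t" "continuous_on UNIV (f :: config \<Rightarrow> real)"
  shows "(LINT x|bind \<nu> (K t). f x) = (LINT x|\<nu>. (LINT y|K t x. f y))"
proof -
  interpret prob_space \<nu> by (rule config_distributionD[OF assms(1)])
  note [measurable_cong] = config_distributionD(2)[OF assms(1)]
  obtain B where B: "\<And>x. norm (f x) \<le> B"
    using continuous_config_bcontfun[OF assms(3)] unfolding bcontfun_def bounded_iff by blast
  show ?thesis
  proof (rule integral_bind[where K = borel and B = B and B' = 1])
    show "f \<in> borel_measurable borel"
      by (rule borel_measurable_continuous_onI[OF assms(3)])
    show "K t \<in> \<nu> \<rightarrow>\<^sub>M subprob_algebra borel"
      using measurable_prob_algebraD[OF kernel[OF assms(2)]] by measurable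
    show "AE x in \<nu>. emeasure (K t x) (space (K t x)) \<le> ennreal 1"
      using config_distributionD(1)[OF kernel_distribution[OF assms(2)]]
      by (simp add: prob_space.emeasure_space_1)
  qed (use B in \<open>auto simp: finite_measure_axioms\<close>)
qed

lemma transition_add:
  assumes "0 \<le> s" "0 \<le> t" "continuous_on UNIV (f :: config \<Rightarrow> real)"
  shows "(LINT y|K (s + t) x. f y) = (LINT y|K s x. (LINT z|K t y. f z))"
  unfolding Chapman_Kolmogorov[OF assms(1,2)]
  by (rule integral_bind_transition[OF kernel_distribution assms(2,3)]) (rule assms(1))

lemma semigroup_op_add:
  assumes "0 \<le> s" "0 \<le> t"
  shows "semigroup_op K (s + t) f = semigroup_op K s (semigroup_op K t f)"
  by (rule bcontfun_eqI) (use assms transition_add in simp)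

lemma norm_semigroup_op_le: "0 \<le> t \<Longrightarrow> norm (semigroup_op K t f) \<le> norm f"
  by (rule norm_bound) (use config_integral_le_norm[OF kernel_distribution] in simp)

lemma integral_start: "continuous_on UNIV (f :: config \<Rightarrow> real) \<Longrightarrow> (LINT y|K 0 x. f y) = f x"
  unfolding start by (intro integral_return borel_measurable_continuous_onI) simp_all

lemma bounded_linear_semigroup_op: "0 \<le> t \<Longrightarrow> bounded_linear (semigroup_op K t)"
proof (rule bounded_linear_intro[where K = 1])
  assume t: "0 \<le> t"
  note B = bounded_linear_config_integral[OF kernel_distribution[OF t]]
  show "semigroup_op K t (f + g) = semigroup_op K t f + semigroup_op K t g" for f g
    by (rule bcontfun_eqI)
      (use linear_add[OF bounded_linear.linear[OF B], of _ f g] t in simp)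
  show "semigroup_op K t (c *\<^sub>R f) = c *\<^sub>R semigroup_op K t f" for c f
    by (rule bcontfun_eqI) (use t in simp)
  show "norm (semigroup_op K t f) \<le> norm f * 1" for f
    using norm_semigroup_op_le[OF t] by simp
qed

text \<open>The operator at time s is bounded and commutes with the semigroup, so it may be applied
  to the difference quotient and then to its limit.\<close>

lemma generator_invariant:
  assumes "(f, g) \<in> generator K" "0 \<le> s"
  shows "(semigroup_op K s f, semigroup_op K s g) \<in> generator K"
proof -
  interpret P: bounded_linear "semigroup_op K s" by (rule bounded_linear_semigroup_op[OF assms(2)])
  have "((\<lambda>t. semigroup_op K s ((1 / t) *\<^sub>R (semigroup_op K t f - f))) \<longlongrightarrow> semigroup_op K s g) (at_right 0)"
    using assms(1) by (intro P.tendsto) (simp add: generator_def)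
  moreover have "eventually (\<lambda>t. semigroup_op K s ((1 / t) *\<^sub>R (semigroup_op K t f - f))
      = (1 / t) *\<^sub>R (semigroup_op K t (semigroup_op K s f) - semigroup_op K s f)) (at_right 0)"
    unfolding eventually_at_right_field
  proof (intro exI[of _ 1] conjI allI impI)
    fix t :: real assume "0 < t"
    then show "semigroup_op K s ((1 / t) *\<^sub>R (semigroup_op K t f - f))
      = (1 / t) *\<^sub>R (semigroup_op K t (semigroup_op K s f) - semigroup_op K s f)"
      using semigroup_op_add[of s t f] semigroup_op_add[of t s f] assms(2)
      by (simp add: P.scaleR P.diff add.commute)
  qed simp
  ultimately show ?thesis
    unfolding generator_def by (simp cong: tendsto_cong)
qed

lemma stationary_integral:
  assumes "stationary K \<nu>" "0 \<le> t" "continuous_on UNIV (f :: config \<Rightarrow> real)"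
  shows "(LINT x|\<nu>. (LINT y|K t x. f y)) = (LINT x|\<nu>. f x)"
  using integral_bind_transition[of \<nu> t f] assms by (simp add: stationary_def)

text \<open>Under a stationary law each difference quotient already has mean 0, and integration is
  continuous in the supremum norm.\<close>

lemma stationary_integral_generator:
  assumes "stationary K \<nu>" "(f, g) \<in> generator K"
  shows "(LINT x|\<nu>. g x) = 0"
proof -
  have \<nu>: "config_distribution \<nu>" using assms(1) by (simp add: stationary_def)
  interpret I: bounded_linear "\<lambda>f :: config \<Rightarrow>\<^sub>C real. LINT x|\<nu>. f x"
    by (rule bounded_linear_config_integral[OF \<nu>])
  have "((\<lambda>t. LINT x|\<nu>. ((1 / t) *\<^sub>R (semigroup_op K t f - f)) x) \<longlongrightarrow> (LINT x|\<nu>. g x)) (at_right 0)"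
    using assms(2) by (intro I.tendsto) (simp add: generator_def)
  moreover have "eventually (\<lambda>t. (LINT x|\<nu>. ((1 / t) *\<^sub>R (semigroup_op K t f - f)) x) = 0) (at_right 0)"
    unfolding eventually_at_right_field
  proof (intro exI[of _ 1] conjI allI impI)
    fix t :: real assume "0 < t"
    then have "(LINT x|\<nu>. semigroup_op K t f x) = (LINT x|\<nu>. f x)"
      using stationary_integral[OF assms(1), of t f] by simp
    then show "(LINT x|\<nu>. ((1 / t) *\<^sub>R (semigroup_op K t f - f)) x) = 0"
      unfolding I.scaleR I.diff by simp
  qed simp
  ultimately have "((\<lambda>t :: real. 0) \<longlongrightarrow> (LINT x|\<nu>. g x)) (at_right 0)"
    by (rule Lim_transform_eventually)
  then show ?thesis
    by (simp add: tendsto_const_iff)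
qed

text \<open>If \<open>\<integral> g d\<nu> = 0\<close> on the whole generator, then \<open>t \<mapsto> \<integral> K\<^sub>t f d\<nu>\<close> has
  derivative zero, uniformly in \<open>t\<close>.\<close>

lemma integral_transition_constant:
  assumes \<nu>: "config_distribution \<nu>"
    and null: "\<And>f g. (f, g) \<in> generator K \<Longrightarrow> (LINT x|\<nu>. g x) = 0"
    and fg: "(f, g) \<in> generator K" and "0 \<le> t"
  shows "(LINT x|\<nu>. (LINT y|K t x. f y)) = (LINT x|\<nu>. f x)"
proof (cases "t = 0")
  case True
  then show ?thesis by (simp add: integral_start)
next
  case False
  with assms have t: "0 < t" by simp
  interpret I: bounded_linear "\<lambda>f :: config \<Rightarrow>\<^sub>C real. LINT x|\<nu>. f x"
    by (rule bounded_linear_config_integral[OF \<nu>])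
  define \<phi> where "\<phi> s = (LINT x|\<nu>. semigroup_op K s f x)" for s
  have "\<bar>\<phi> t - (LINT x|\<nu>. f x)\<bar> \<le> 0 + e" if "0 < e" for e
  proof -
    have "eventually (\<lambda>h. dist ((1 / h) *\<^sub>R (semigroup_op K h f - f)) g < e / t) (at_right 0)"
      using fg t that by (intro tendstoD) (simp_all add: generator_def)
    then obtain d where d: "0 < d" "\<And>h. 0 < h \<Longrightarrow> h < d \<Longrightarrow> dist ((1 / h) *\<^sub>R (semigroup_op K h f - f)) g < e / t"
      unfolding eventually_at_right_field by blast
    obtain n :: nat where n: "t / d < real n" using reals_Archimedean2 by blast
    \<comment> \<open>The mesh divides t exactly and lies below d, so the one derivative estimate at
      time 0, accurate to \<open>e / t\<close>, serves in each of the n steps and the errors add up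
      to e.\<close>
    define h where "h = t / real n"
    have "0 < real n" using n t d(1) by (meson divide_pos_pos less_trans)
    then have h: "0 < h" "h < d" "real n * h = t"
      using n t d(1) by (auto simp: h_def field_simps)
    define r where "r = (1 / h) *\<^sub>R (semigroup_op K h f - f) - g"
    have r: "norm r \<le> e / t"
      using d(2)[OF h(1,2)] by (simp add: r_def dist_norm)
    \<comment> \<open>At time \<open>real k * h\<close> the main term integrates to 0 by
      \<open>null\<close>, because the generator is preserved by the semigroup; the remainder r is
      carried there by a contraction and keeps its bound.\<close>
    have step: "\<bar>\<phi> (real (Suc k) * h) - \<phi> (real k * h)\<bar> \<le> h * (e / t)" for k
    proof -
      have k: "0 \<le> real k * h" using h(1) by simp
      interpret P: bounded_linear "semigroup_op K (real k * h)"
        by (rule bounded_linear_semigroup_op[OF k])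
      have "semigroup_op K h f = f + h *\<^sub>R (g + r)"
        using h(1) by (simp add: r_def)
      then have "semigroup_op K (real k * h + h) f =
          semigroup_op K (real k * h) f + h *\<^sub>R (semigroup_op K (real k * h) g + semigroup_op K (real k * h) r)"
        using semigroup_op_add[OF k, of h f] h(1) by (simp add: P.add P.scaleR)
      then have "\<phi> (real k * h + h) =
          \<phi> (real k * h) + h * ((LINT x|\<nu>. semigroup_op K (real k * h) g x) + (LINT x|\<nu>. semigroup_op K (real k * h) r x))"
        unfolding \<phi>_def by (simp only: I.add I.scaleR real_scaleR_def)
      moreover have "(LINT x|\<nu>. semigroup_op K (real k * h) g x) = 0"
        by (rule null[OF generator_invariant[OF fg k]])
      moreover have "\<bar>LINT x|\<nu>. semigroup_op K (real k * h) r x\<bar> \<le> e / t"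
        using config_integral_le_norm[OF \<nu>, of "semigroup_op K (real k * h) r"]
          norm_semigroup_op_le[OF k, of r] r by linarith
      moreover have "real (Suc k) * h = real k * h + h" by (simp add: algebra_simps)
      ultimately show ?thesis
        using h(1) by (simp add: abs_mult mult_left_mono del: of_nat_Suc apply_semigroup_op times_divide_eq_right)
    qed
    have "\<bar>\<phi> (real k * h) - \<phi> 0\<bar> \<le> real k * (h * (e / t))" for k
    proof (induction k)
      case (Suc k)
      have "real (Suc k) * (h * (e / t)) = real k * (h * (e / t)) + h * (e / t)"
        unfolding of_nat_Suc by (simp only: distrib_right mult_1 add.commute)
      then show ?case using step[of k] Suc by linarith
    qed simp
    from this[of n] have "\<bar>\<phi> t - \<phi> 0\<bar> \<le> e"
      using h(3) t by (simp flip: mult.assoc)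
    moreover have "semigroup_op K 0 f = f"
      by (rule bcontfun_eqI) (simp add: integral_start)
    ultimately show ?thesis by (simp add: \<phi>_def)
  qed
  then have "\<bar>\<phi> t - (LINT x|\<nu>. f x)\<bar> \<le> 0" by (rule field_le_epsilon)
  then show ?thesis using t by (simp add: \<phi>_def)
qed

text \<open>Indicators of cylinders are local, hence lie in the domain, and their means are constant
  in time by \<open>integral_transition_constant\<close>; cylinders determine the law.\<close>

lemma stationaryI_generator:
  assumes \<nu>: "config_distribution \<nu>"
    and null: "\<And>f g. (f, g) \<in> generator K \<Longrightarrow> (LINT x|\<nu>. g x) = 0"
    and dom: "\<And>f :: config \<Rightarrow>\<^sub>C real. local_function (apply_bcontfun f) \<Longrightarrow> f \<in> Domain (generator K)"
  shows "stationary K \<nu>"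
  unfolding stationary_def
proof (intro conjI allI impI \<nu>)
  fix t :: real assume t: "0 \<le> t"
  show "bind \<nu> (K t) = \<nu>"
  proof (rule config_distribution_eqI[OF distribution_bind[OF \<nu> t] \<nu>])
    fix A assume A: "A \<in> cylinders"
    then obtain J where J: "finite J" "depends_on J (\<lambda>x. x \<in> A)" by (auto simp: cylinders_def)
    let ?f = "indicator A :: config \<Rightarrow> real"
    have f: "depends_on J ?f"
      using J(2) by (auto simp: depends_on_def indicator_def)
    have c: "continuous_on UNIV ?f" by (rule depends_on_continuous[OF J(1) f])
    have "Bcontfun ?f \<in> Domain (generator K)"
      using J(1) f c by (intro dom) (auto simp: local_function_iff)
    then obtain g where "(Bcontfun ?f, g) \<in> generator K" by blast
    from integral_transition_constant[OF \<nu> null this t]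
    have "(LINT x|bind \<nu> (K t). ?f x) = (LINT x|\<nu>. ?f x)"
      using integral_bind_transition[OF \<nu> t c] c by simp
    then show "measure (bind \<nu> (K t)) A = measure \<nu> A"
      using cylinders_open[OF A] config_distributionD[OF \<nu>]
        config_distributionD[OF distribution_bind[OF \<nu> t]] by simp
  qed
qed

text \<open>Otherwise the time averages of the laws started at badly chosen points would have a cluster
  point, invariant under \<open>K\<^sub>\<delta>\<close>, under which \<open>f\<close> has the wrong mean; but a law invariant under
  \<open>K\<^sub>\<delta>\<close> is \<open>\<pi>\<close> by ergodicity.\<close>

lemma uniform_Cesaro:
  assumes erg: "ergodic K \<pi>" and f: "continuous_on UNIV (f :: config \<Rightarrow> real)"
    and \<delta>: "0 < \<delta>" and e: "0 < e"
  obtains m :: nat where "0 < m"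
    "\<And>x. \<bar>(\<Sum>j<m. LINT y|K (real j * \<delta>) x. f y) / real m - (LINT x|\<pi>. f x)\<bar> \<le> e"
proof (rule ccontr)
  assume "\<not> thesis"
  then have "\<exists>x. e < \<bar>(\<Sum>j<Suc n. LINT y|K (real j * \<delta>) x. f y) / real (Suc n) - (LINT x|\<pi>. f x)\<bar>" for n
    using that[of "Suc n"] by (meson linorder_not_less zero_less_Suc)
  then obtain x where x:
    "\<And>n. e < \<bar>(\<Sum>j<Suc n. LINT y|K (real j * \<delta>) (x n). f y) / real (Suc n) - (LINT x|\<pi>. f x)\<bar>"
    by metis
  \<comment> \<open>\<open>a n\<close> integrates against the time average of the laws started at
    the bad point \<open>x n\<close>; \<open>Suc n\<close> keeps the divisor positive.\<close>
  define a where "a n h = (\<Sum>j<Suc n. LINT y|K (real j * \<delta>) (x n). apply_bcontfun h y) / real (Suc n)"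
    for n and h :: "config \<Rightarrow>\<^sub>C real"
  have \<delta>j: "0 \<le> real j * \<delta>" for j using \<delta> by simp
  have K_le: "\<bar>LINT y|K (real j * \<delta>) z. apply_bcontfun h y\<bar> \<le> norm h" for j z h
    by (rule config_integral_le_norm[OF kernel_distribution[OF \<delta>j]])
  have int: "integrable (K (real j * \<delta>) z) (apply_bcontfun h)"
    for j z and h :: "config \<Rightarrow>\<^sub>C real"
    by (rule integrable_config[OF kernel_distribution[OF \<delta>j]]) simp
  have "\<bar>a n h\<bar> \<le> norm h" for n h
  proof -
    have "\<bar>\<Sum>j<Suc n. LINT y|K (real j * \<delta>) (x n). apply_bcontfun h y\<bar> \<le> (\<Sum>j<Suc n. norm h)"
      by (rule order_trans[OF sum_abs sum_mono]) (rule K_le)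
    then show ?thesis by (simp add: a_def field_simps)
  qed
  then obtain G l where G: "G \<noteq> bot" "G \<le> sequentially" "\<And>h. ((\<lambda>n. a n h) \<longlongrightarrow> l h) G"
    by (rule cluster_point_of_bounded[of a norm]) blast
  have l_eq: "l h = c" if "((\<lambda>n. a n h) \<longlongrightarrow> c) G" for h c
    using tendsto_unique[OF G(1) G(3) that] .
  have "\<exists>\<nu>. config_distribution \<nu> \<and> (\<forall>h. continuous_on UNIV h \<longrightarrow> l (Bcontfun h) = (LINT x|\<nu>. h x))"
  proof (rule Riesz_config[of "\<lambda>h. l (Bcontfun h)"])
    fix h k :: "config \<Rightarrow> real" and c :: real
    assume h: "continuous_on UNIV h"
    have "a n (Bcontfun (\<lambda>x. c * h x)) = c * a n (Bcontfun h)" for n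
      using continuous_on_mult_left[OF h, of c] h by (simp add: a_def sum_distrib_left distrib_left)
    then show "l (Bcontfun (\<lambda>x. c * h x)) = c * l (Bcontfun h)"
      by (intro l_eq) (simp add: tendsto_mult_left G(3))
    show "0 \<le> l (Bcontfun h)" if "\<And>x. 0 \<le> h x"
    proof (rule tendsto_lowerbound[OF G(3) _ G(1)])
      have "0 \<le> a n (Bcontfun h)" for n
        unfolding a_def apply_Bcontfun_config[OF h]
        by (intro divide_nonneg_nonneg sum_nonneg Bochner_Integration.integral_nonneg that of_nat_0_le_iff)
      then show "eventually (\<lambda>n. 0 \<le> a n (Bcontfun h)) G" by simp
    qed
    assume k: "continuous_on UNIV k"
    have "a n (Bcontfun (\<lambda>x. h x + k x)) = a n (Bcontfun h) + a n (Bcontfun k)" for n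
      using continuous_on_add[OF h k] h k int[of _ _ "Bcontfun h"] int[of _ _ "Bcontfun k"]
      by (simp add: a_def sum.distrib add_divide_distrib)
    then show "l (Bcontfun (\<lambda>x. h x + k x)) = l (Bcontfun h) + l (Bcontfun k)"
      by (intro l_eq) (simp add: tendsto_add G(3))
  next
    have "(LINT y|K (real j * \<delta>) z. 1 :: real) = 1" for j z
      using prob_space.prob_space[OF config_distributionD(1)[OF kernel_distribution[OF \<delta>j]]] by simp
    then have "a n (Bcontfun (\<lambda>x. 1)) = 1" for n
      by (simp add: a_def)
    then show "l (Bcontfun (\<lambda>x. 1)) = 1"
      by (intro l_eq) simp
  qed blast
  then obtain \<nu> where \<nu>: "config_distribution \<nu>"
    and l: "\<And>h. continuous_on UNIV h \<Longrightarrow> l (Bcontfun h) = (LINT x|\<nu>. h x)"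
    by blast
  have invariant: "(LINT x|\<nu>. (LINT y|K \<delta> x. h y)) = (LINT x|\<nu>. h x)"
    if h: "continuous_on UNIV h" for h :: "config \<Rightarrow> real"
  proof -
    define k where "k = (\<lambda>x. LINT y|K \<delta> x. h y)"
    have k: "continuous_on UNIV k"
      unfolding k_def using continuous_transition[of \<delta> h] \<delta> h by simp
    have K_k: "(LINT y|K (real j * \<delta>) z. k y) = (LINT y|K (real (Suc j) * \<delta>) z. h y)" for j z
      using transition_add[OF \<delta>j[of j] less_imp_le[OF \<delta>] h, of z] by (simp add: k_def algebra_simps)
    \<comment> \<open>Applying the transition operator once more moves the averaging window by one
      step, so only the two end terms survive.\<close>
    have diff: "a n (Bcontfun k) - a n (Bcontfun h) =
        ((LINT y|K (real (Suc n) * \<delta>) (x n). h y) - (LINT y|K (real 0 * \<delta>) (x n). h y)) / real (Suc n)" for n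
      unfolding a_def apply_Bcontfun_config[OF h] apply_Bcontfun_config[OF k] K_k
        diff_divide_distrib[symmetric] sum_subtractf[symmetric]
      by (subst sum_lessThan_telescope) (rule refl)
    have bound: "\<bar>a n (Bcontfun k) - a n (Bcontfun h)\<bar> \<le> 2 * norm (Bcontfun h) / real (Suc n)" for n
    proof -
      have "\<bar>(LINT y|K (real (Suc n) * \<delta>) (x n). h y) - (LINT y|K (real 0 * \<delta>) (x n). h y)\<bar>
          \<le> 2 * norm (Bcontfun h)"
        using K_le[of "Suc n" "x n" "Bcontfun h"] K_le[of 0 "x n" "Bcontfun h"]
        unfolding apply_Bcontfun_config[OF h] by linarith
      then show ?thesis unfolding diff abs_divide by (simp add: divide_right_mono del: of_nat_Suc)
    qed
    have "(\<lambda>n. 2 * norm (Bcontfun h) / real (Suc n)) \<longlonglongrightarrow> 0"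
      using LIMSEQ_Suc[OF lim_const_over_n] .
    then have "(\<lambda>n. a n (Bcontfun k) - a n (Bcontfun h)) \<longlonglongrightarrow> 0"
      by (rule Lim_null_comparison[OF always_eventually, rotated])
        (simp only: real_norm_def bound simp_thms)
    then have "((\<lambda>n. a n (Bcontfun k) - a n (Bcontfun h)) \<longlongrightarrow> 0) G"
      by (rule tendsto_mono[OF G(2)])
    from tendsto_add[OF this G(3)[of "Bcontfun h"]] have "l (Bcontfun k) = l (Bcontfun h)"
      by (intro l_eq) simp
    then show ?thesis using l[OF h] l[OF k] by (simp add: k_def)
  qed
  \<comment> \<open>Started from \<nu>, the mean of f is the same at all times
    \<open>real j * \<delta>\<close>, while ergodicity makes it converge to the \<pi>-mean; hence
    the two means agree.\<close>
  have "(LINT x|\<nu>. h x) = (LINT x|bind \<nu> (K (real j * \<delta>)). h x)" if h: "continuous_on UNIV h"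
    for h :: "config \<Rightarrow> real" and j
    unfolding integral_bind_transition[OF \<nu> \<delta>j h]
  proof (induction j)
    case 0
    then show ?case by (simp add: integral_start[OF h])
  next
    case (Suc j)
    have "(LINT y|K (real (Suc j) * \<delta>) z. h y) = (LINT y|K \<delta> z. (LINT u|K (real j * \<delta>) y. h u))" for z
      using transition_add[OF less_imp_le[OF \<delta>] \<delta>j[of j] h, of z] by (simp add: algebra_simps)
    then show ?case
      using invariant[OF continuous_transition[OF \<delta>j[of j] h]] Suc by simp
  qed
  moreover have "((\<lambda>t. LINT x|bind \<nu> (K t). f x) \<longlongrightarrow> (LINT x|\<pi>. f x)) at_top"
  proof -
    have "((\<lambda>t. LINT x|bind \<nu> (K t). Bcontfun f x) \<longlongrightarrow> (LINT x|\<pi>. Bcontfun f x)) at_top"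
      using erg \<nu> unfolding ergodic_def by blast
    then show ?thesis by (simp only: apply_Bcontfun_config[OF f])
  qed
  moreover have "filterlim (\<lambda>j. real j * \<delta>) at_top sequentially"
    by (intro filterlim_at_top_mult_tendsto_pos[OF tendsto_const \<delta>] filterlim_real_sequentially)
  ultimately have "(\<lambda>j. LINT x|\<nu>. f x) \<longlonglongrightarrow> (LINT x|\<pi>. f x)"
    using filterlim_compose[of "\<lambda>t. LINT x|bind \<nu> (K t). f x" _ at_top "\<lambda>j. real j * \<delta>" sequentially] f
    by simp
  then have mean: "(LINT x|\<nu>. f x) = (LINT x|\<pi>. f x)"
    by (rule LIMSEQ_unique[OF tendsto_const])
  \<comment> \<open>Along G the averages of f tend to the \<pi>-mean, yet by choice of
    \<open>x n\<close> they all stay more than e away from it.\<close>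
  have "((\<lambda>n. \<bar>a n (Bcontfun f) - (LINT x|\<pi>. f x)\<bar>) \<longlongrightarrow> \<bar>l (Bcontfun f) - (LINT x|\<pi>. f x)\<bar>) G"
    by (intro tendsto_intros G(3))
  then have "((\<lambda>n. \<bar>a n (Bcontfun f) - (LINT x|\<pi>. f x)\<bar>) \<longlongrightarrow> 0) G"
    using l[OF f] mean by simp
  then have "e \<le> 0"
    by (rule tendsto_lowerbound[OF _ _ G(1)])
      (use x f in \<open>auto simp: a_def intro!: always_eventually less_imp_le\<close>)
  then show False using e by simp
qed

end

section \<open>Spin systems\<close>

lemma depends_on_flip_sum:
  assumes "finite J" "depends_on J f"
  shows "(\<Sum>\<^sub>\<infinity>i\<in>UNIV. flip_rate p i x * (f (flip i x) - f x)) =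
    (\<Sum>i\<in>J. flip_rate p i x * (f (flip i x) - f x :: real))"
proof -
  have "f (flip i x) = f x" if "i \<notin> J" for i
    using that by (intro depends_onD[OF assms(2)]) (auto simp: flip_def)
  then have "(\<Sum>\<^sub>\<infinity>i\<in>UNIV. flip_rate p i x * (f (flip i x) - f x)) =
      (\<Sum>\<^sub>\<infinity>i\<in>J. flip_rate p i x * (f (flip i x) - f x))"
    by (intro infsum_cong_neutral) auto
  then show ?thesis using assms(1) by simp
qed

lemma flip_rate_depends: "depends_on {i - 1, i, i + 1} (flip_rate p i)"
  by (auto simp: depends_on_def flip_rate_def nbhd_def status_def)

text \<open>Each rate reads three sites only, so the image of a local function is again local, hence
  continuous. This puts every local function into the domain and gives its image as a finite
  sum.\<close>

lemma pregenerator_exists: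
  assumes "finite J" "depends_on J f"
  obtains g where "(Bcontfun f, g) \<in> spin_pregenerator p"
    "\<And>x. apply_bcontfun g x = (\<Sum>i\<in>J. flip_rate p i x * (f (flip i x) - f x))"
proof -
  define g where "g x = (\<Sum>i\<in>J. flip_rate p i x * (f (flip i x) - f x))" for x
  let ?J = "J \<union> (\<Union>i\<in>J. {i - 1, i, i + 1})"
  have g: "depends_on ?J g"
    unfolding depends_on_def
  proof (intro allI impI)
    fix x y :: config assume xy: "\<forall>i\<in>?J. x i = y i"
    have "flip_rate p i x = flip_rate p i y" if "i \<in> J" for i
      by (rule depends_onD[OF flip_rate_depends]) (use xy that in blast)
    moreover have "f (flip i x) = f (flip i y)" for i
      by (rule depends_onD[OF assms(2)]) (use xy in \<open>auto simp: flip_def\<close>)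
    moreover have "f x = f y"
      by (rule depends_onD[OF assms(2)]) (use xy in blast)
    ultimately show "g x = g y" unfolding g_def by (intro sum.cong) auto
  qed
  have "continuous_on UNIV g"
    by (rule depends_on_continuous[OF _ g]) (use assms(1) in auto)
  then have "apply_bcontfun (Bcontfun g) = g" by simp
  moreover have "apply_bcontfun (Bcontfun f) = f"
    using depends_on_continuous[OF assms] by simp
  ultimately show ?thesis
    using assms depends_on_flip_sum[OF assms, of p]
    by (intro that[of "Bcontfun g"]) (auto simp: spin_pregenerator_def g_def local_function_iff)
qed

section \<open>Translations of configurations\<close>

definition shift :: "int \<Rightarrow> config \<Rightarrow> config" where
  "shift a x = (\<lambda>i. x (i + a))"

lemma continuous_shift: "continuous_on UNIV (shift a)"
  unfolding shift_def
  by (intro continuous_on_coordinatewise_then_product continuous_on_product_coordinates)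

lemma apply_Bcontfun_shift:
  "apply_bcontfun (Bcontfun (\<lambda>x. apply_bcontfun f (shift a x))) = (\<lambda>x. apply_bcontfun f (shift a x) :: real)"
  by (intro apply_Bcontfun_config continuous_on_compose2[OF _ continuous_shift, of UNIV]) auto

lemma shift_measurable: "shift a \<in> borel \<rightarrow>\<^sub>M borel"
  by (rule borel_measurable_continuous_onI[OF continuous_shift])

lemma shift_flip: "shift a (flip i x) = flip (i - a) (shift a x)"
  by (auto simp: shift_def flip_def fun_eq_iff)

lemma flip_rate_shift: "flip_rate p i x = flip_rate p (i - a) (shift a x)"
  by (simp add: shift_def flip_rate_def nbhd_def status_def algebra_simps)

text \<open>One rule governs all sites (\<open>flip_rate_shift\<close>), so translating the
  configuration merely reindexes the sum over sites.\<close>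

lemma spin_pregenerator_shift:
  assumes "(f, g) \<in> spin_pregenerator p"
  shows "(Bcontfun (\<lambda>x. f (shift a x)), Bcontfun (\<lambda>x. g (shift a x))) \<in> spin_pregenerator p"
proof -
  obtain J where J: "finite J" "depends_on J (apply_bcontfun f)"
    and g: "\<And>x. g x = (\<Sum>\<^sub>\<infinity>i\<in>UNIV. flip_rate p i x * (f (flip i x) - f x))"
    using assms by (auto simp: spin_pregenerator_def local_function_iff)
  have "depends_on ((\<lambda>i. i + a) ` J) (\<lambda>x. f (shift a x))"
    unfolding depends_on_def by (intro allI impI depends_onD[OF J(2)]) (simp add: shift_def)
  then have loc: "local_function (\<lambda>x. f (shift a x))"
    unfolding local_function_iff using finite_imageI[OF J(1)] by blast
  have eq: "g (shift a x) =
      (\<Sum>\<^sub>\<infinity>i\<in>UNIV. flip_rate p i x * (f (shift a (flip i x)) - f (shift a x)))" for x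
  proof -
    have "bij_betw (\<lambda>i. i - a) UNIV UNIV"
      by (rule bij_betwI[of _ _ _ "\<lambda>i. i + a"]) auto
    from infsum_reindex_bij_betw[OF this, of "\<lambda>i. flip_rate p i (shift a x) *
        (f (flip i (shift a x)) - f (shift a x))"]
    show ?thesis
      unfolding g shift_flip flip_rate_shift[of p _ x a] by (rule sym)
  qed
  show ?thesis
    unfolding spin_pregenerator_def mem_Collect_eq case_prod_conv apply_Bcontfun_shift
    by (intro conjI allI loc eq)
qed

section \<open>Shift invariance and marginals of the stationary distribution\<close>

locale ergodic_spin_system =
  fixes p :: "nat \<Rightarrow> real" and K :: "real \<Rightarrow> config \<Rightarrow> config measure" and \<pi> :: "config measure"
  assumes system: "spin_system p K" and ergodic: "ergodic K \<pi>"
begin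

sublocale feller_transition K
  using system by (simp add: spin_system_def)

lemma generator_eq: "generator K = closure (spin_pregenerator p)"
  using system by (simp add: spin_system_def)

lemma stationary_\<pi>: "stationary K \<pi>" and stationary_unique: "stationary K \<nu> \<Longrightarrow> \<nu> = \<pi>"
  using ergodic unfolding ergodic_def by blast+

lemma distribution_\<pi>: "config_distribution \<pi>"
  using stationary_\<pi> by (simp add: stationary_def)

text \<open>That the shifted law annihilates the generator needs checking on local functions only:
  the pairs whose second component has mean 0 form a closed set, and the generator is the closure of
  the pregenerator.\<close>

lemma shift_invariant: "distr \<pi> borel (shift a) = \<pi>"
proof (rule stationary_unique, rule stationaryI_generator)
  let ?\<nu> = "distr \<pi> borel (shift a)"
  have shift: "shift a \<in> \<pi> \<rightarrow>\<^sub>M borel"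
    using shift_measurable config_distributionD(2)[OF distribution_\<pi>]
    by (simp cong: measurable_cong_sets)
  show \<nu>: "config_distribution ?\<nu>"
    using prob_space.prob_space_distr[OF config_distributionD(1)[OF distribution_\<pi>] shift]
    by (simp add: config_distribution_def)
  let ?N = "{z :: (config \<Rightarrow>\<^sub>C real) \<times> (config \<Rightarrow>\<^sub>C real). (LINT x|?\<nu>. apply_bcontfun (snd z) x) = 0}"
  have "spin_pregenerator p \<subseteq> ?N"
  proof
    fix z assume "z \<in> spin_pregenerator p"
    then obtain f g where z: "z = (f, g)" and "(f, g) \<in> spin_pregenerator p"
      by (cases z) simp
    then have "(Bcontfun (\<lambda>x. f (shift a x)), Bcontfun (\<lambda>x. g (shift a x))) \<in> generator K"
      using spin_pregenerator_shift closure_subset unfolding generator_eq by blast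
    from stationary_integral_generator[OF stationary_\<pi> this]
    have "(LINT x|\<pi>. g (shift a x)) = 0"
      by (simp only: apply_Bcontfun_shift)
    moreover have "apply_bcontfun g \<in> borel_measurable borel"
      by (rule borel_measurable_continuous_onI) simp
    ultimately have "(LINT x|?\<nu>. g x) = 0"
      using integral_distr[OF shift, of "apply_bcontfun g"] by (simp only:)
    then show "z \<in> ?N" by (simp add: z)
  qed
  moreover have "closed ?N"
  proof -
    interpret I: bounded_linear "\<lambda>f :: config \<Rightarrow>\<^sub>C real. LINT x|?\<nu>. f x"
      by (rule bounded_linear_config_integral[OF \<nu>])
    show ?thesis
      by (intro closed_Collect_eq I.continuous_on continuous_on_snd continuous_on_id continuous_on_const)
  qed
  ultimately have "generator K \<subseteq> ?N"
    unfolding generator_eq by (rule closure_minimal)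
  then show "(LINT x|?\<nu>. g x) = 0" if "(f, g) \<in> generator K" for f g
    using that unfolding mem_Collect_eq subset_iff by (metis snd_conv)
  show "f \<in> Domain (generator K)" if "local_function (apply_bcontfun f)" for f :: "config \<Rightarrow>\<^sub>C real"
  proof -
    obtain J where "finite J" "depends_on J (apply_bcontfun f)"
      using \<open>local_function (apply_bcontfun f)\<close> by (auto simp: local_function_iff)
    then obtain g where "(f, g) \<in> spin_pregenerator p"
      by (rule pregenerator_exists[of J f p, unfolded apply_bcontfun_inverse])
    then show ?thesis
      using closure_subset unfolding generator_eq by blast
  qed
qed

lemma sets_config:
  assumes "finite J" "depends_on J P"
  shows "{x. P x} \<in> sets \<pi>"
proof -
  have "{x. P x} \<in> cylinders"
    unfolding cylinders_def mem_Collect_eq using assms by blast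
  then show ?thesis
    using cylinders_open config_distributionD(2)[OF distribution_\<pi>] by simp
qed

lemma measure_shift:
  assumes "finite J" "depends_on J P"
  shows "measure \<pi> {x. P (shift a x)} = measure \<pi> {x. P x}"
proof -
  have shift: "shift a \<in> \<pi> \<rightarrow>\<^sub>M borel"
    using shift_measurable config_distributionD(2)[OF distribution_\<pi>]
    by (simp cong: measurable_cong_sets)
  have "measure (distr \<pi> borel (shift a)) {x. P x} = measure \<pi> (shift a -` {x. P x} \<inter> space \<pi>)"
    by (rule measure_distr[OF shift])
      (use sets_config[OF assms] config_distributionD(2)[OF distribution_\<pi>] in simp)
  then show ?thesis
    by (simp add: shift_invariant config_distributionD(3)[OF distribution_\<pi>] vimage_def)
qed

lemma marginal1_shift: "marginal1 \<pi> i u = marginal1 \<pi> 0 u"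
proof -
  have "depends_on {0} (\<lambda>x. status x 0 = u)"
    by (auto simp: depends_on_def status_def)
  from measure_shift[OF _ this, of i] show ?thesis
    by (simp add: marginal1_def status_def shift_def)
qed

lemma marginal2_shift: "marginal2 \<pi> (i - 1) (i + 1) u v = marginal2 \<pi> (- 1) 1 u v"
proof -
  have "depends_on {- 1, 1} (\<lambda>x. status x (- 1) = u \<and> status x 1 = v)"
    by (auto simp: depends_on_def status_def)
  from measure_shift[OF _ this, of i] show ?thesis
    by (simp add: marginal2_def status_def shift_def algebra_simps)
qed

lemma marginal1_sum: "marginal1 \<pi> 0 0 + marginal1 \<pi> 0 1 = 1"
proof -
  interpret prob_space \<pi> by (rule config_distributionD[OF distribution_\<pi>])
  have "prob {x. x 0} + prob {x. \<not> x 0} = prob ({x. x 0} \<union> {x. \<not> x 0})"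
    by (rule finite_measure_Union[symmetric])
      (auto intro!: sets_config[of "{0}"] simp: depends_on_def)
  also have "{x. x 0} \<union> {x. \<not> x 0} = space \<pi>"
    using config_distributionD(3)[OF distribution_\<pi>] by auto
  finally show ?thesis
    by (simp add: marginal1_def status_def prob_space)
qed

lemma integral_nbhd:
  "(LINT x|\<pi>. f (nbhd 0 x)) =
    marginal2 \<pi> (-1) 1 0 0 * f 0 + marginal2 \<pi> (-1) 1 0 1 * f 1
    + marginal2 \<pi> (-1) 1 1 0 * f 2 + marginal2 \<pi> (-1) 1 1 1 * (f 3 :: real)"
proof -
  interpret prob_space \<pi> by (rule config_distributionD[OF distribution_\<pi>])
  let ?A = "\<lambda>u v. {x :: config. status x (- 1) = u \<and> status x 1 = v}"
  have A: "?A u v \<in> sets \<pi>" for u v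
    by (rule sets_config[of "{- 1, 1}"]) (auto simp: depends_on_def status_def)
  have int: "integrable \<pi> (\<lambda>x. indicator (?A u v) x * c)" for u v and c :: real
    using A by (intro integrable_mult_left integrable_real_indicator) (auto simp: less_top[symmetric])
  have "(LINT x|\<pi>. f (nbhd 0 x)) =
      (LINT x|\<pi>. indicator (?A 0 0) x * f 0 + indicator (?A 0 1) x * f 1
        + indicator (?A 1 0) x * f 2 + indicator (?A 1 1) x * f 3)"
    by (rule Bochner_Integration.integral_cong) (auto simp: nbhd_def status_def indicator_def eval_nat_numeral)
  also have "\<dots> = prob (?A 0 0) * f 0 + prob (?A 0 1) * f 1 + prob (?A 1 0) * f 2 + prob (?A 1 1) * f 3"
    using A int by (simp add: config_distributionD(3)[OF distribution_\<pi>])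
  finally show ?thesis by (simp add: marginal2_def)
qed

lemma marginal2_sum:
  "marginal2 \<pi> (-1) 1 0 0 + marginal2 \<pi> (-1) 1 0 1 + marginal2 \<pi> (-1) 1 1 0 + marginal2 \<pi> (-1) 1 1 1 = 1"
  using integral_nbhd[of "\<lambda>_. 1"]
    prob_space.prob_space[OF config_distributionD(1)[OF distribution_\<pi>]] by simp

lemma integral_win_probability: "(LINT x|\<pi>. p (nbhd 0 x)) = marginal1 \<pi> 0 1"
proof -
  have f: "depends_on {0} (\<lambda>x :: config. of_bool (x 0) :: real)"
    by (simp add: depends_on_def)
  obtain g where "(Bcontfun (\<lambda>x. of_bool (x 0)), g) \<in> spin_pregenerator p"
    and g: "\<And>x. apply_bcontfun g x =
      (\<Sum>i\<in>{0}. flip_rate p i x * (of_bool (flip i x 0) - of_bool (x 0)))"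
    by (rule pregenerator_exists[OF _ f, of p]) auto
  then have "(LINT x|\<pi>. g x) = 0"
    using closure_subset by (intro stationary_integral_generator[OF stationary_\<pi>]) (auto simp: generator_eq)
  \<comment> \<open>From state 0 the flip adds 1 at rate p, from state 1 it subtracts 1 at rate
    \<open>1 - p\<close>; either way the result is p minus the present status.\<close>
  moreover have "apply_bcontfun g = (\<lambda>x. p (nbhd 0 x) - indicator {x. x 0} x)"
    by (auto simp: fun_eq_iff g flip_rate_def flip_def)
  moreover have "integrable \<pi> (\<lambda>x. p (nbhd 0 x))"
    by (intro integrable_config[OF distribution_\<pi>] depends_on_continuous[of "{- 1, 1}"])
      (auto simp: depends_on_def nbhd_def status_def)
  moreover have "integrable \<pi> (indicator {x. x 0} :: config \<Rightarrow> real)"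
    by (intro integrable_config[OF distribution_\<pi>] depends_on_continuous[of "{0}"])
      (auto simp: depends_on_def indicator_def)
  moreover have "marginal1 \<pi> 0 1 = (LINT x|\<pi>. indicator {x. x 0} x)"
    using config_distributionD(3)[OF distribution_\<pi>] by (simp add: marginal1_def status_def)
  ultimately show ?thesis by simp
qed

end

section \<open>A strong law of large numbers\<close>

context prob_space
begin

text \<open>The series of the \<open>Y n\<close> has finite expectation, so it converges almost
  surely and its terms tend to 0.\<close>

lemma AE_tendsto_0_of_summable_expectation:
  fixes Y :: "nat \<Rightarrow> 'a \<Rightarrow> real"
  assumes int: "\<And>n. integrable M (Y n)" and nonneg: "\<And>n \<omega>. 0 \<le> Y n \<omega>"
    and le: "\<And>n. expectation (Y n) \<le> b n" and sum: "summable b"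
  shows "AE \<omega> in M. (\<lambda>n. Y n \<omega>) \<longlonglongrightarrow> 0"
proof -
  have meas [measurable]: "Y n \<in> borel_measurable M" for n using int by simp
  have b: "0 \<le> b n" for n
    using order_trans[OF integral_nonneg_AE le] nonneg by (metis AE_I2)
  have "(\<integral>\<^sup>+\<omega>. (\<Sum>n. ennreal (Y n \<omega>)) \<partial>M) = (\<Sum>n. (\<integral>\<^sup>+\<omega>. ennreal (Y n \<omega>) \<partial>M))"
    by (rule nn_integral_suminf) simp
  also have "\<dots> = (\<Sum>n. ennreal (expectation (Y n)))"
    using int nonneg by (simp add: nn_integral_eq_integral)
  also have "\<dots> \<le> (\<Sum>n. ennreal (b n))"
    by (intro suminf_le) (auto intro: ennreal_leI le)
  also have "\<dots> < \<infinity>"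
    using suminf_ennreal2[OF b sum] by simp
  finally have "(\<integral>\<^sup>+\<omega>. (\<Sum>n. ennreal (Y n \<omega>)) \<partial>M) \<noteq> \<infinity>" by simp
  then have "AE \<omega> in M. (\<Sum>n. ennreal (Y n \<omega>)) \<noteq> \<infinity>"
    by (intro nn_integral_PInf_AE) simp_all
  then show ?thesis
  proof eventually_elim
    case (elim \<omega>)
    then have "summable (\<lambda>n. Y n \<omega>)"
      using nonneg by (intro summable_suminf_not_top) auto
    then show ?case by (rule summable_LIMSEQ_zero)
  qed
qed

text \<open>Along squares, Chebyshev's inequality suffices; the fluctuations in the block between
  \<open>n\<^sup>2\<close> and \<open>(n + 1)\<^sup>2\<close> are controlled by the Cauchy-Schwarz inequality.\<close>

lemma strong_law_orthogonal:
  fixes U :: "nat \<Rightarrow> 'a \<Rightarrow> real"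
  assumes meas [measurable]: "\<And>k. U k \<in> borel_measurable M"
    and sq: "\<And>k. integrable M (\<lambda>\<omega>. (U k \<omega>)\<^sup>2)" "\<And>k. expectation (\<lambda>\<omega>. (U k \<omega>)\<^sup>2) \<le> C"
    and orth: "\<And>j k. j < k \<Longrightarrow> expectation (\<lambda>\<omega>. U j \<omega> * U k \<omega>) = 0"
  shows "AE \<omega> in M. (\<lambda>n. (\<Sum>k<n. U k \<omega>) / real n) \<longlonglongrightarrow> 0"
proof -
  have C: "0 \<le> C"
    using order_trans[OF _ sq(2)[of 0]] by simp
  have prod: "integrable M (\<lambda>\<omega>. U j \<omega> * U k \<omega>)" for j k
  proof (rule Bochner_Integration.integrable_bound)
    show "integrable M (\<lambda>\<omega>. (U j \<omega>)\<^sup>2 + (U k \<omega>)\<^sup>2)" using sq(1) by simp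
    have "\<bar>x * y\<bar> \<le> x\<^sup>2 + y\<^sup>2" for x y :: real
    proof -
      have "2 * \<bar>x * y\<bar> \<le> x\<^sup>2 + y\<^sup>2"
        using sum_squares_bound[of "\<bar>x\<bar>" "\<bar>y\<bar>"] by (simp add: abs_mult mult.assoc)
      then show ?thesis by linarith
    qed
    then show "AE \<omega> in M. norm (U j \<omega> * U k \<omega>) \<le> norm ((U j \<omega>)\<^sup>2 + (U k \<omega>)\<^sup>2)"
      by simp
  qed simp
  have inverse_squares: "summable (\<lambda>n. 1 / real n ^ 2)"
    using inverse_power_summable[of 2, where 'a = real] by (simp add: inverse_eq_divide)
  have sq_sum: "(\<Sum>k\<in>A. f k)\<^sup>2 = (\<Sum>j\<in>A. \<Sum>k\<in>A. f j * f k)" for A and f :: "nat \<Rightarrow> real"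
    by (simp add: power2_eq_square sum_product)
  \<comment> \<open>Orthogonality bounds the second moment of the first \<open>n\<^sup>2\<close>
    terms by \<open>n\<^sup>2 * C\<close>; after division by \<open>n ^ 4\<close> this is
    summable.\<close>
  have "AE \<omega> in M. (\<lambda>n. (\<Sum>k<n\<^sup>2. U k \<omega>)\<^sup>2 / real n ^ 4) \<longlonglongrightarrow> 0"
  proof (rule AE_tendsto_0_of_summable_expectation)
    show "integrable M (\<lambda>\<omega>. (\<Sum>k<n\<^sup>2. U k \<omega>)\<^sup>2 / real n ^ 4)" for n
      unfolding sq_sum using prod by simp
    have "expectation (\<lambda>\<omega>. (\<Sum>k<m. U k \<omega>)\<^sup>2) \<le> real m * C" for m
    proof -
      have "expectation (\<lambda>\<omega>. (\<Sum>k<m. U k \<omega>)\<^sup>2) = (\<Sum>j<m. \<Sum>k<m. expectation (\<lambda>\<omega>. U j \<omega> * U k \<omega>))"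
        unfolding sq_sum using prod by (simp add: Bochner_Integration.integral_sum)
      also have "\<dots> = (\<Sum>j<m. \<Sum>k<m. if k = j then expectation (\<lambda>\<omega>. (U j \<omega>)\<^sup>2) else 0)"
      proof (intro sum.cong refl)
        fix j k
        show "expectation (\<lambda>\<omega>. U j \<omega> * U k \<omega>) = (if k = j then expectation (\<lambda>\<omega>. (U j \<omega>)\<^sup>2) else 0)"
          using orth[of j k] orth[of k j]
          by (cases j k rule: linorder_cases) (auto simp: power2_eq_square mult.commute)
      qed
      also have "\<dots> = (\<Sum>j<m. expectation (\<lambda>\<omega>. (U j \<omega>)\<^sup>2))"
        by simp
      also have "\<dots> \<le> real m * C"
        using sum_mono[of "{..<m}" "\<lambda>j. expectation (\<lambda>\<omega>. (U j \<omega>)\<^sup>2)" "\<lambda>_. C"] sq(2) by simp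
      finally show ?thesis .
    qed
    then have "expectation (\<lambda>\<omega>. (\<Sum>k<n\<^sup>2. U k \<omega>)\<^sup>2) / real n ^ 4 \<le> (real (n\<^sup>2) * C) / real n ^ 4" for n
      by (intro divide_right_mono) (simp_all only: zero_le_power of_nat_0_le_iff)
    moreover have "(real (n\<^sup>2) * C) / real n ^ 4 = C * (1 / real n ^ 2)" for n
      by (cases "n = 0") (simp_all add: power4_eq_xxxx power2_eq_square field_simps)
    ultimately show "expectation (\<lambda>\<omega>. (\<Sum>k<n\<^sup>2. U k \<omega>)\<^sup>2 / real n ^ 4) \<le> C * (1 / real n ^ 2)" for n
      by simp
    show "summable (\<lambda>n. C * (1 / real n ^ 2))"
      by (rule summable_mult[OF inverse_squares])
  qed simp
  \<comment> \<open>Absolute values make the block sum dominate every partial sum inside the block.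
    Orthogonality is lost, but for positive n the block has \<open>2 * n + 1 \<le> 3 * n\<close>
    terms, which gives the factor 9 and is still summable.\<close>
  moreover have "AE \<omega> in M. (\<lambda>n. (\<Sum>k\<in>{n\<^sup>2..<(Suc n)\<^sup>2}. \<bar>U k \<omega>\<bar>)\<^sup>2 / real n ^ 4) \<longlonglongrightarrow> 0"
  proof (rule AE_tendsto_0_of_summable_expectation)
    have abs: "integrable M (\<lambda>\<omega>. \<bar>U j \<omega>\<bar> * \<bar>U k \<omega>\<bar>)" for j k
      using integrable_abs[OF prod[of j k]] by (simp add: abs_mult)
    show int: "integrable M (\<lambda>\<omega>. (\<Sum>k\<in>{n\<^sup>2..<(Suc n)\<^sup>2}. \<bar>U k \<omega>\<bar>)\<^sup>2 / real n ^ 4)" for n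
      unfolding sq_sum using abs by simp
    show "expectation (\<lambda>\<omega>. (\<Sum>k\<in>{n\<^sup>2..<(Suc n)\<^sup>2}. \<bar>U k \<omega>\<bar>)\<^sup>2 / real n ^ 4)
        \<le> 9 * C * (1 / real n ^ 2)" for n
    proof (cases "n = 0")
      case False
      let ?A = "{n\<^sup>2..<(Suc n)\<^sup>2}"
      have "card ?A = 2 * n + 1" by (simp add: power2_eq_square)
      with False have card: "real (card ?A) \<le> 3 * real n" by linarith
      have "expectation (\<lambda>\<omega>. (\<Sum>k\<in>?A. \<bar>U k \<omega>\<bar>)\<^sup>2) \<le> expectation (\<lambda>\<omega>. real (card ?A) * (\<Sum>k\<in>?A. (U k \<omega>)\<^sup>2))"
      proof (rule integral_mono)
        show "integrable M (\<lambda>\<omega>. (\<Sum>k\<in>?A. \<bar>U k \<omega>\<bar>)\<^sup>2)" unfolding sq_sum using abs by simp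
        show "integrable M (\<lambda>\<omega>. real (card ?A) * (\<Sum>k\<in>?A. (U k \<omega>)\<^sup>2))" using sq(1) by simp
        show "(\<Sum>k\<in>?A. \<bar>U k \<omega>\<bar>)\<^sup>2 \<le> real (card ?A) * (\<Sum>k\<in>?A. (U k \<omega>)\<^sup>2)" for \<omega>
          using Cauchy_Schwarz_ineq_sum[of "\<lambda>_. 1" "\<lambda>k. \<bar>U k \<omega>\<bar>" ?A] by simp
      qed
      also have "\<dots> = real (card ?A) * (\<Sum>k\<in>?A. expectation (\<lambda>\<omega>. (U k \<omega>)\<^sup>2))"
        using sq(1) by (simp add: Bochner_Integration.integral_sum)
      also have "\<dots> \<le> real (card ?A) * (real (card ?A) * C)"
        using sum_mono[of ?A "\<lambda>j. expectation (\<lambda>\<omega>. (U j \<omega>)\<^sup>2)" "\<lambda>_. C"] sq(2)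
        by (intro mult_left_mono) auto
      also have "\<dots> \<le> (3 * real n) * ((3 * real n) * C)"
        using C by (intro mult_mono mult_right_mono card) auto
      finally have "expectation (\<lambda>\<omega>. (\<Sum>k\<in>?A. \<bar>U k \<omega>\<bar>)\<^sup>2) / real n ^ 4 \<le> (3 * real n) * ((3 * real n) * C) / real n ^ 4"
        by (rule divide_right_mono) simp
      also have "\<dots> = 9 * C * (1 / real n ^ 2)"
        using False by (simp add: power4_eq_xxxx power2_eq_square field_simps)
      finally show ?thesis by simp
    qed simp
    show "summable (\<lambda>n. 9 * C * (1 / real n ^ 2))"
      by (rule summable_mult[OF inverse_squares])
  qed simp
  ultimately show ?thesis
  proof eventually_elim
    case (elim \<omega>)
    let ?S = "\<lambda>n. \<Sum>k<n. U k \<omega>" and ?V = "\<lambda>n. \<Sum>k\<in>{n\<^sup>2..<(Suc n)\<^sup>2}. \<bar>U k \<omega>\<bar>"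
    have root: "sqrt (x\<^sup>2 / real n ^ 4) = \<bar>x\<bar> / real n ^ 2" for x n
    proof -
      have "x\<^sup>2 / real n ^ 4 = (\<bar>x\<bar> / real n ^ 2)\<^sup>2"
        by (simp add: power_divide flip: power_mult)
      then show ?thesis by simp
    qed
    have "(\<lambda>n. sqrt ((?S (n\<^sup>2))\<^sup>2 / real n ^ 4) + sqrt ((?V n)\<^sup>2 / real n ^ 4)) \<longlonglongrightarrow> sqrt 0 + sqrt 0"
      by (intro tendsto_add tendsto_real_sqrt elim)
    then have lim: "(\<lambda>n. \<bar>?S (n\<^sup>2)\<bar> / real n ^ 2 + \<bar>?V n\<bar> / real n ^ 2) \<longlonglongrightarrow> 0"
      unfolding root by simp
    have floor_sqrt: "filterlim (\<lambda>n. nat \<lfloor>sqrt (real n)\<rfloor>) at_top sequentially"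
      unfolding filterlim_at_top
    proof
      fix Z :: nat
      have "Z \<le> nat \<lfloor>sqrt (real n)\<rfloor>" if "Z\<^sup>2 \<le> n" for n
      proof -
        have "real Z \<le> sqrt (real n)"
          using that by (intro real_le_rsqrt) (simp flip: of_nat_power)
        then show ?thesis by (simp add: le_nat_floor)
      qed
      then show "eventually (\<lambda>n. Z \<le> nat \<lfloor>sqrt (real n)\<rfloor>) sequentially"
        by (rule eventually_sequentiallyI)
    qed
    have "norm (?S n / real n) \<le> \<bar>?S ((nat \<lfloor>sqrt (real n)\<rfloor>)\<^sup>2)\<bar> / real (nat \<lfloor>sqrt (real n)\<rfloor>) ^ 2
        + \<bar>?V (nat \<lfloor>sqrt (real n)\<rfloor>)\<bar> / real (nat \<lfloor>sqrt (real n)\<rfloor>) ^ 2" if n: "1 \<le> n" for n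
    proof -
      \<comment> \<open>m is the index of the block containing n, that is
        \<open>m\<^sup>2 \<le> n < (Suc m)\<^sup>2\<close>.\<close>
      define m where "m = nat \<lfloor>sqrt (real n)\<rfloor>"
      have m_real: "real m = of_int \<lfloor>sqrt (real n)\<rfloor>" by (simp add: m_def)
      have "real m \<le> sqrt (real n)" "sqrt (real n) < real m + 1"
        unfolding m_real by linarith+
      then have "(real m)\<^sup>2 \<le> real n" "real n < (real m + 1)\<^sup>2"
        using power_mono[of "real m" "sqrt (real n)" 2] power_strict_mono[of "sqrt (real n)" "real m + 1" 2]
        by auto
      then have "real (m\<^sup>2) \<le> real n" "real n < real ((Suc m)\<^sup>2)"
        by (simp_all add: add.commute)
      then have m: "m\<^sup>2 \<le> n" "n < (Suc m)\<^sup>2" by (simp_all only: of_nat_le_iff of_nat_less_iff)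
      have "0 < m" using m(2) n by (cases m) auto
      have "?S n = ?S (m\<^sup>2) + (\<Sum>k\<in>{m\<^sup>2..<n}. U k \<omega>)"
        using sum.atLeastLessThan_concat[of 0 "m\<^sup>2" n "\<lambda>k. U k \<omega>"] m(1) by (simp add: atLeast0LessThan)
      moreover have "\<bar>\<Sum>k\<in>{m\<^sup>2..<n}. U k \<omega>\<bar> \<le> ?V m"
        by (rule order_trans[OF sum_abs sum_mono2]) (use m in auto)
      ultimately have "\<bar>?S n\<bar> \<le> \<bar>?S (m\<^sup>2)\<bar> + \<bar>?V m\<bar>" by linarith
      then have "\<bar>?S n\<bar> / real n \<le> (\<bar>?S (m\<^sup>2)\<bar> + \<bar>?V m\<bar>) / real m ^ 2"
        using m(1) \<open>0 < m\<close> n \<open>(real m)\<^sup>2 \<le> real n\<close> by (intro frac_le) auto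
      then show ?thesis by (simp add: add_divide_distrib flip: m_def)
    qed
    then show ?case
      by (intro Lim_null_comparison[OF _ filterlim_compose[OF lim floor_sqrt]] eventually_sequentiallyI[of 1])
  qed
qed

end

section \<open>Poisson increments\<close>

lemma pmf_nat_expectation:
  fixes g :: "nat \<Rightarrow> real"
  assumes "\<And>n. 0 \<le> g n" "(\<lambda>n. pmf p n * g n) sums s"
  shows "integrable (measure_pmf p) g" "(LINT n|measure_pmf p. g n) = s"
proof -
  have "integrable (count_space UNIV) (\<lambda>n. pmf p n * g n)"
    unfolding integrable_count_space_nat_iff
    using assms by (simp add: abs_mult sums_iff)
  then show "integrable (measure_pmf p) g"
    unfolding measure_pmf_eq_density by (subst integrable_density) auto
  have "(LINT n|measure_pmf p. g n) = (LINT n|count_space UNIV. pmf p n * g n)"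
    unfolding measure_pmf_eq_density by (subst integral_density) auto
  also have "\<dots> = s"
    using integral_count_space_nat[OF \<open>integrable (count_space UNIV) (\<lambda>n. pmf p n * g n)\<close>] assms(2)
    by (simp add: sums_iff)
  finally show "(LINT n|measure_pmf p. g n) = s" .
qed

text \<open>Both moments follow from the identity that \<open>n + 1\<close> times the weight at
  \<open>n + 1\<close> equals r times the weight at n: the first moment sums it directly, the second
  multiplies it by \<open>n + 1\<close> first.\<close>

lemma poisson_moments:
  assumes r: "0 < r"
  shows "integrable (measure_pmf (poisson_pmf r)) real"
    and "(LINT n|measure_pmf (poisson_pmf r). real n) = r"
    and "integrable (measure_pmf (poisson_pmf r)) (\<lambda>n. (real n)\<^sup>2)"
    and "(LINT n|measure_pmf (poisson_pmf r). (real n)\<^sup>2) = r\<^sup>2 + r"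
proof -
  let ?p = "\<lambda>n. r ^ n / fact n * exp (- r)"
  have "(\<lambda>n. r ^ n / fact n) sums exp r"
    using exp_converges[of r] by (simp add: divide_inverse mult.commute)
  from sums_mult2[OF this, of "exp (- r)"] have p: "?p sums 1"
    by (simp flip: exp_add)
  have Suc: "?p (Suc n) * real (Suc n) = r * ?p n" for n
    by (simp add: field_simps del: of_nat_Suc)
  have mean: "(\<lambda>n. ?p n * real n) sums r"
  proof -
    have "(\<lambda>n. ?p (Suc n) * real (Suc n)) sums r"
      unfolding Suc using sums_mult[OF p, of r] by simp
    from sums_Suc_imp[OF _ this] show ?thesis by simp
  qed
  have "?p (Suc n) * (real (Suc n))\<^sup>2 = r * (?p n * real n) + r * ?p n" for n
  proof -
    have "?p (Suc n) * (real (Suc n))\<^sup>2 = r * ?p n * real (Suc n)"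
      unfolding power2_eq_square mult.assoc[symmetric] Suc ..
    then show ?thesis
      by (simp only: of_nat_Suc distrib_left mult_1_right mult.assoc add.commute)
  qed
  moreover have "(\<lambda>n. r * (?p n * real n) + r * ?p n) sums (r * r + r * 1)"
    by (intro sums_add sums_mult mean p)
  ultimately have "(\<lambda>n. ?p (Suc n) * (real (Suc n))\<^sup>2) sums (r * r + r * 1)"
    by simp
  from sums_Suc_imp[OF _ this] have square: "(\<lambda>n. ?p n * (real n)\<^sup>2) sums (r\<^sup>2 + r)"
    by (simp add: power2_eq_square)
  show "integrable (measure_pmf (poisson_pmf r)) real"
    and "(LINT n|measure_pmf (poisson_pmf r). real n) = r"
    by (rule pmf_nat_expectation; use mean r in simp)+
  show "integrable (measure_pmf (poisson_pmf r)) (\<lambda>n. (real n)\<^sup>2)"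
    and "(LINT n|measure_pmf (poisson_pmf r). (real n)\<^sup>2) = r\<^sup>2 + r"
    by (rule pmf_nat_expectation; use square r in simp)+
qed

section \<open>Play counts and their increments\<close>

context spin_play
begin

text \<open>The plays up to time t form an initial segment of the indices, finite because the play
  times diverge, so the cardinality is the first index not yet reached. The inequality is strict
  because plays are numbered from 0.\<close>

lemma num_plays_less_iff:
  assumes "\<omega> \<in> space M"
  shows "n < num_plays T i t \<omega> \<longleftrightarrow> T i n \<omega> \<le> t"
proof -
  have mono: "T i m \<omega> \<le> T i n \<omega>" if "m \<le> n" for m n
    using strict_mono_less_eq[OF play_times(2)[OF assms]] that by blast
  have "eventually (\<lambda>n. t < T i n \<omega>) sequentially"
    using play_times(3)[OF assms] by (simp add: filterlim_at_top_dense)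
  then obtain k where k: "t < T i k \<omega>"
    using eventually_happens[of _ sequentially] by auto
  define m where "m = (LEAST k. t < T i k \<omega>)"
  have m: "t < T i m \<omega>" unfolding m_def by (rule LeastI[of "\<lambda>k. t < T i k \<omega>", OF k])
  have iff: "T i n \<omega> \<le> t \<longleftrightarrow> n < m" for n
  proof
    show "n < m" if "T i n \<omega> \<le> t"
      using mono[of m n] m that by (meson leI le_less_trans less_irrefl)
    show "T i n \<omega> \<le> t" if "n < m"
      using not_less_Least[of n "\<lambda>k. t < T i k \<omega>"] that unfolding m_def by simp
  qed
  have "{n. T i n \<omega> \<le> t} = {..<m}" unfolding iff by blast
  then show ?thesis unfolding num_plays_def iff by simp
qed

lemma num_plays_mono: "\<omega> \<in> space M \<Longrightarrow> s \<le> t \<Longrightarrow> num_plays T i s \<omega> \<le> num_plays T i t \<omega>"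
  by (meson num_plays_less_iff less_irrefl linorder_not_less order_trans)

lemma num_plays_0: "\<omega> \<in> space M \<Longrightarrow> num_plays T i 0 \<omega> = 0"
  using num_plays_less_iff[of \<omega> 0 i 0] play_times(1)[of \<omega> i] by simp

lemma num_plays_measurable:
  assumes "s \<le> t"
  shows "num_plays T i s \<in> F t \<rightarrow>\<^sub>M count_space UNIV"
proof (subst measurable_count_space_eq_countable, simp, intro conjI ballI)
  fix a
  have [measurable]: "Measurable.pred (F t) (\<lambda>\<omega>. T i n \<omega> \<le> s)" for n
    by (rule stopping_time_le_const[OF play_stopping_time assms])
  have "num_plays T i s \<omega> = a \<longleftrightarrow> (\<forall>n<a. T i n \<omega> \<le> s) \<and> \<not> T i a \<omega> \<le> s" if "\<omega> \<in> space M" for \<omega>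
    unfolding num_plays_less_iff[OF that, symmetric]
    by (metis less_irrefl linorder_cases)
  then have "num_plays T i s -` {a} \<inter> space (F t) =
      {\<omega> \<in> space (F t). (\<forall>n<a. T i n \<omega> \<le> s) \<and> \<not> T i a \<omega> \<le> s}"
    unfolding space_F by auto
  also have "\<dots> \<in> sets (F t)" by measurable
  finally show "num_plays T i s -` {a} \<inter> space (F t) \<in> sets (F t)" .
qed auto

lemma measurable_F_M: "f \<in> F t \<rightarrow>\<^sub>M N \<Longrightarrow> f \<in> M \<rightarrow>\<^sub>M N"
  using measurable_from_subalg[OF filtration_sub] .

lemma measurable_F_mono: "f \<in> F s \<rightarrow>\<^sub>M N \<Longrightarrow> s \<le> t \<Longrightarrow> f \<in> F t \<rightarrow>\<^sub>M N"
  by (rule measurable_from_subalg[of _ "F s"]) (simp_all add: subalgebra_def space_F sets_F_mono)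

text \<open>Subtraction of naturals truncates nothing here, since counts grow with time on
  \<open>space M\<close>; the form is that of the Poisson assumptions.\<close>

definition increment :: "int \<Rightarrow> real \<Rightarrow> real \<Rightarrow> 'w \<Rightarrow> nat" where
  "increment i s t \<omega> = num_plays T i t \<omega> - num_plays T i s \<omega>"

lemma increment_measurable_F: "s \<le> t \<Longrightarrow> increment i s t \<in> F t \<rightarrow>\<^sub>M count_space UNIV"
  unfolding increment_def[abs_def]
  using num_plays_measurable[of t t i] num_plays_measurable[of s t i] by measurable

lemma increment_measurable: "s \<le> t \<Longrightarrow> increment i s t \<in> M \<rightarrow>\<^sub>M count_space UNIV"
  by (rule measurable_F_M[OF increment_measurable_F])

lemma increment_expectation:
  fixes g :: "nat \<Rightarrow> real"
  assumes "0 \<le> s" "s < t" "integrable (measure_pmf (poisson_pmf (t - s))) g"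
  shows "integrable M (\<lambda>\<omega>. g (increment i s t \<omega>))"
    and "expectation (\<lambda>\<omega>. g (increment i s t \<omega>)) = (LINT n|measure_pmf (poisson_pmf (t - s)). g n)"
proof -
  have distr: "distr M (count_space UNIV) (increment i s t) = measure_pmf (poisson_pmf (t - s))"
    using plays_Poisson[OF assms(1,2), of i] by (simp add: increment_def[abs_def])
  note meas = increment_measurable[OF less_imp_le[OF assms(2)], of i]
  show "integrable M (\<lambda>\<omega>. g (increment i s t \<omega>))"
    using assms(3) unfolding distr[symmetric] by (subst (asm) integrable_distr_eq[OF meas]) auto
  show "expectation (\<lambda>\<omega>. g (increment i s t \<omega>)) = (LINT n|measure_pmf (poisson_pmf (t - s)). g n)"
    unfolding distr[symmetric] by (rule integral_distr[OF meas, symmetric]) simp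
qed

text \<open>The past is one more index, \<open>None\<close>, carrying an arbitrary variable V known
  at time s; expectations of V times counts of several players then factorise at once.\<close>

lemma increments_indep:
  fixes g :: "nat \<Rightarrow> real"
  assumes "0 \<le> s" "s < t" and V: "V \<in> borel_measurable (F s)"
  shows "indep_vars (\<lambda>_. borel) (case_option V (\<lambda>i \<omega>. g (increment i s t \<omega>))) UNIV"
  unfolding indep_vars_def2
proof (intro conjI ballI)
  note meas = increment_measurable[OF less_imp_le[OF assms(2)]]
  show "random_variable borel (case_option V (\<lambda>i \<omega>. g (increment i s t \<omega>)) j)" for j
    using measurable_F_M[OF V] measurable_compose[OF meas, of g borel] by (cases j) auto
  show "indep_sets (\<lambda>j. {case_option V (\<lambda>i \<omega>. g (increment i s t \<omega>)) j -` A \<inter> space M |A. A \<in> sets borel}) UNIV"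
  proof (rule indep_sets_mono_sets[OF plays_indep[OF assms(1,2)]])
    fix j :: "int option"
    show "{case_option V (\<lambda>i \<omega>. g (increment i s t \<omega>)) j -` A \<inter> space M |A. A \<in> sets borel}
      \<subseteq> (case j of None \<Rightarrow> sets (F s) | Some i \<Rightarrow> sets (vimage_algebra (space M)
            (\<lambda>\<omega>. num_plays T i t \<omega> - num_plays T i s \<omega>) (count_space UNIV)))"
    proof (cases j)
      case None
      then show ?thesis using measurable_sets[OF V] by (auto simp: space_F)
    next
      case (Some i)
      have "(\<lambda>\<omega>. g (increment i s t \<omega>)) -` A \<inter> space M \<in> sets (vimage_algebra (space M)
            (\<lambda>\<omega>. num_plays T i t \<omega> - num_plays T i s \<omega>) (count_space UNIV))" for A
        using in_vimage_algebra[of "g -` A" "count_space UNIV"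
            "\<lambda>\<omega>. num_plays T i t \<omega> - num_plays T i s \<omega>" "space M"]
        by (simp add: increment_def vimage_def)
      then show ?thesis using Some by auto
    qed
  qed
qed

lemma increments_product:
  fixes g :: "nat \<Rightarrow> real"
  assumes st: "0 \<le> s" "s < t" and V: "V \<in> borel_measurable (F s)" "integrable M V"
    and g: "integrable (measure_pmf (poisson_pmf (t - s))) g" and J: "finite J"
  shows "integrable M (\<lambda>\<omega>. V \<omega> * (\<Prod>i\<in>J. g (increment i s t \<omega>)))"
    and "expectation (\<lambda>\<omega>. V \<omega> * (\<Prod>i\<in>J. g (increment i s t \<omega>))) =
      expectation V * (LINT n|measure_pmf (poisson_pmf (t - s)). g n) ^ card J"
proof -
  let ?X = "case_option V (\<lambda>i \<omega>. g (increment i s t \<omega>))" and ?I = "insert None (Some ` J)"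
  have indep: "indep_vars (\<lambda>_. borel) ?X ?I"
    by (rule indep_vars_subset[OF increments_indep[OF st V(1)]]) simp
  have int: "integrable M (?X j)" for j
    using V(2) increment_expectation(1)[OF st g] by (cases j) auto
  have prod: "(\<Prod>j\<in>?I. ?X j \<omega>) = V \<omega> * (\<Prod>i\<in>J. g (increment i s t \<omega>))" for \<omega>
    using J by (subst prod.insert) (auto simp: prod.reindex)
  show "integrable M (\<lambda>\<omega>. V \<omega> * (\<Prod>i\<in>J. g (increment i s t \<omega>)))"
    using indep_vars_integrable[OF _ indep int] J unfolding prod by simp
  have "expectation (\<lambda>\<omega>. V \<omega> * (\<Prod>i\<in>J. g (increment i s t \<omega>))) = (\<Prod>j\<in>?I. expectation (?X j))"
    using indep_vars_lebesgue_integral[OF _ indep int] J unfolding prod by simp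
  also have "\<dots> = expectation V * (\<Prod>i\<in>J. expectation (\<lambda>\<omega>. g (increment i s t \<omega>)))"
    using J by (subst prod.insert) (auto simp: prod.reindex)
  finally show "expectation (\<lambda>\<omega>. V \<omega> * (\<Prod>i\<in>J. g (increment i s t \<omega>))) =
      expectation V * (LINT n|measure_pmf (poisson_pmf (t - s)). g n) ^ card J"
    by (simp add: increment_expectation(2)[OF st g])
qed

text \<open>The weight \<open>\<phi> k\<close> is known when interval k begins, and the product of
  the counts is independent of that past with mean \<open>\<delta> ^ card J\<close>; so the centred
  terms are orthogonal. J consists of player 0 alone when plays are counted, and of player 0 with
  one neighbour when joint plays are.\<close>

lemma strong_law_increments:
  fixes \<phi> :: "nat \<Rightarrow> 'w \<Rightarrow> real"
  assumes \<delta>: "0 < \<delta>" and J: "finite J"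
    and \<phi>: "\<And>k. \<phi> k \<in> borel_measurable (F (real k * \<delta>))" "\<And>k \<omega>. \<bar>\<phi> k \<omega>\<bar> \<le> 1"
  shows "AE \<omega> in M. (\<lambda>n. (\<Sum>k<n. \<phi> k \<omega> *
    ((\<Prod>i\<in>J. real (increment i (real k * \<delta>) (real (Suc k) * \<delta>) \<omega>)) - \<delta> ^ card J)) / real n) \<longlonglongrightarrow> 0"
proof (rule strong_law_orthogonal)
  define W where "W k \<omega> = (\<Prod>i\<in>J. real (increment i (real k * \<delta>) (real (Suc k) * \<delta>) \<omega>))" for k \<omega>
  define U where "U k \<omega> = \<phi> k \<omega> * (W k \<omega> - \<delta> ^ card J)" for k \<omega>
  have st: "0 \<le> real k * \<delta>" "real k * \<delta> < real (Suc k) * \<delta>"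
    "real (Suc k) * \<delta> - real k * \<delta> = \<delta>" for k
    using \<delta> by (simp_all add: algebra_simps)
  note moments = poisson_moments[OF \<delta>]
  have WV: "integrable M (\<lambda>\<omega>. V \<omega> * W k \<omega>)" "expectation (\<lambda>\<omega>. V \<omega> * W k \<omega>) = expectation V * \<delta> ^ card J"
    if V: "V \<in> borel_measurable (F (real k * \<delta>))" "integrable M V" for V k
  proof -
    have "integrable (measure_pmf (poisson_pmf (real (Suc k) * \<delta> - real k * \<delta>))) real"
      unfolding st(3) by (rule moments(1))
    note prod = increments_product[OF st(1,2) V this J, unfolded st(3) moments(2)]
    show "integrable M (\<lambda>\<omega>. V \<omega> * W k \<omega>)" "expectation (\<lambda>\<omega>. V \<omega> * W k \<omega>) = expectation V * \<delta> ^ card J"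
      unfolding W_def by (rule prod)+
  qed
  have W2: "integrable M (\<lambda>\<omega>. (W k \<omega>)\<^sup>2)" "expectation (\<lambda>\<omega>. (W k \<omega>)\<^sup>2) = (\<delta>\<^sup>2 + \<delta>) ^ card J" for k
  proof -
    have "integrable (measure_pmf (poisson_pmf (real (Suc k) * \<delta> - real k * \<delta>))) (\<lambda>n. (real n)\<^sup>2)"
      unfolding st(3) by (rule moments(3))
    note prod = increments_product[OF st(1,2) borel_measurable_const[of 1] integrable_const[of 1] this J,
        unfolded st(3) moments(4) mult_1]
    show "integrable M (\<lambda>\<omega>. (W k \<omega>)\<^sup>2)" "expectation (\<lambda>\<omega>. (W k \<omega>)\<^sup>2) = (\<delta>\<^sup>2 + \<delta>) ^ card J"
      using prod by (simp_all add: W_def prob_space flip: prod_power_distrib)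
  qed
  have W1: "integrable M (W k)" "expectation (W k) = \<delta> ^ card J" for k
    using WV[OF borel_measurable_const[of 1] integrable_const[of 1], of k] by (simp_all add: prob_space)
  have W_meas: "W k \<in> borel_measurable (F (real (Suc k) * \<delta>))" for k
    unfolding W_def[abs_def]
    by (intro borel_measurable_prod measurable_compose[OF increment_measurable_F] less_imp_le[OF st(2)]) simp
  have U_meas: "U k \<in> borel_measurable (F (real (Suc k) * \<delta>))" for k
    unfolding U_def[abs_def]
    using W_meas[of k] measurable_F_mono[OF \<phi>(1) less_imp_le[OF st(2)]] by measurable
  show meas: "U k \<in> borel_measurable M" for k
    by (rule measurable_F_M[OF U_meas])
  have W_diff: "integrable M (\<lambda>\<omega>. (W k \<omega> - \<delta> ^ card J)\<^sup>2)"
    "expectation (\<lambda>\<omega>. (W k \<omega> - \<delta> ^ card J)\<^sup>2) \<le> (\<delta>\<^sup>2 + \<delta>) ^ card J" for k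
    using W2[of k] W1[of k] by (simp_all add: power2_diff prob_space power2_eq_square[of "\<delta> ^ card J"])
  have U_le: "(U k \<omega>)\<^sup>2 \<le> (W k \<omega> - \<delta> ^ card J)\<^sup>2" for k \<omega>
  proof -
    have "(\<phi> k \<omega>)\<^sup>2 \<le> 1" using \<phi>(2)[of k \<omega>] by (simp add: abs_square_le_1)
    from mult_right_mono[OF this, of "(W k \<omega> - \<delta> ^ card J)\<^sup>2"] show ?thesis
      by (simp add: U_def power_mult_distrib)
  qed
  show U2: "integrable M (\<lambda>\<omega>. (U k \<omega>)\<^sup>2)" for k
    by (rule Bochner_Integration.integrable_bound[OF W_diff(1)]) (use meas U_le in \<open>auto\<close>)
  show "expectation (\<lambda>\<omega>. (U k \<omega>)\<^sup>2) \<le> (\<delta>\<^sup>2 + \<delta>) ^ card J" for k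
    by (rule order_trans[OF integral_mono[OF U2 W_diff(1) U_le] W_diff(2)])
  have U1: "integrable M (U k)" for k
    by (rule square_integrable_imp_integrable[OF meas U2])
  fix j k :: nat assume "j < k"
  \<comment> \<open>Interval j ends no later than interval k begins, so \<open>U j\<close> and
    \<open>\<phi> k\<close> both belong to the past from which the counts in interval k are
    independent.\<close>
  then have "real (Suc j) * \<delta> \<le> real k * \<delta>"
    using \<delta> by (intro mult_right_mono) auto
  then have V: "(\<lambda>\<omega>. U j \<omega> * \<phi> k \<omega>) \<in> borel_measurable (F (real k * \<delta>))"
    using \<phi>(1)[of k] measurable_F_mono[OF U_meas[of j]] by measurable
  have V_int: "integrable M (\<lambda>\<omega>. U j \<omega> * \<phi> k \<omega>)"
  proof (rule Bochner_Integration.integrable_bound[OF U1[of j]])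
    show "AE \<omega> in M. norm (U j \<omega> * \<phi> k \<omega>) \<le> norm (U j \<omega>)"
      using \<phi>(2)[of k] by (simp add: abs_mult mult_left_le)
  qed (rule measurable_F_M[OF V])
  have "expectation (\<lambda>\<omega>. U j \<omega> * U k \<omega>) =
      expectation (\<lambda>\<omega>. U j \<omega> * \<phi> k \<omega> * W k \<omega> - U j \<omega> * \<phi> k \<omega> * \<delta> ^ card J)"
    by (simp add: U_def algebra_simps)
  also have "\<dots> = 0"
    using WV[OF V V_int] V_int by simp
  finally show "expectation (\<lambda>\<omega>. U j \<omega> * U k \<omega>) = 0" .
qed

end

section \<open>Time averages and wins\<close>

text \<open>This replaces an abstract conditional expectation by a version R known almost
  everywhere, such as the transition integral in the Markov property, when testing against a
  variable V of the past.\<close>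

lemma (in spin_play) subalgebra_cond_exp:
  assumes G: "subalgebra M G" and V: "V \<in> borel_measurable G" and Z: "Z \<in> borel_measurable M"
    and int: "integrable M (\<lambda>\<omega>. V \<omega> * Z \<omega>)" and AE: "AE \<omega> in M. real_cond_exp M G Z \<omega> = R \<omega>"
    and R: "R \<in> borel_measurable M"
  shows "expectation (\<lambda>\<omega>. V \<omega> * Z \<omega>) = expectation (\<lambda>\<omega>. V \<omega> * R \<omega>)"
    and "integrable M (\<lambda>\<omega>. V \<omega> * R \<omega>)"
proof -
  interpret finite_measure_subalgebra M G by unfold_locales (rule G)
  have V': "V \<in> borel_measurable M" by (rule measurable_from_subalg[OF G V])
  have eq: "AE \<omega> in M. V \<omega> * real_cond_exp M G Z \<omega> = V \<omega> * R \<omega>"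
    using AE by eventually_elim simp
  have meas: "(\<lambda>\<omega>. V \<omega> * real_cond_exp M G Z \<omega>) \<in> borel_measurable M" "(\<lambda>\<omega>. V \<omega> * R \<omega>) \<in> borel_measurable M"
    using V' R by measurable
  note ce = real_cond_exp_intg[OF int V Z]
  show "expectation (\<lambda>\<omega>. V \<omega> * Z \<omega>) = expectation (\<lambda>\<omega>. V \<omega> * R \<omega>)"
    unfolding ce(2)[symmetric] by (rule integral_cong_AE[OF meas eq])
  show "integrable M (\<lambda>\<omega>. V \<omega> * R \<omega>)"
    using ce(1) integrable_cong_AE[OF meas eq] by blast
qed

section \<open>Averages along the skeleton chain\<close>

locale ergodic_spin_play = ergodic_spin_system p K \<pi> + spin_play M F p K X T
  for p :: "nat \<Rightarrow> real"
    and K :: "real \<Rightarrow> config \<Rightarrow> config measure"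
    and \<pi> :: "config measure"
    and M :: "'w measure" and F :: "real \<Rightarrow> 'w measure"
    and X :: "real \<Rightarrow> 'w \<Rightarrow> config"
    and T :: "int \<Rightarrow> nat \<Rightarrow> 'w \<Rightarrow> real" +
  assumes p01: "m \<le> 3 \<Longrightarrow> p m \<in> {0..1}"
begin

lemma continuous_X_measurable:
  "0 \<le> t \<Longrightarrow> continuous_on UNIV (f :: config \<Rightarrow> real) \<Longrightarrow> (\<lambda>\<omega>. f (X t \<omega>)) \<in> borel_measurable (F t)"
  by (rule measurable_compose[OF adapted borel_measurable_continuous_onI])

text \<open>By the Markov property the summands are bounded martingale differences for the
  filtration on the grid, hence orthogonal.\<close>

lemma strong_law_Markov_step:
  assumes \<delta>: "0 < \<delta>" and f: "continuous_on UNIV (f :: config \<Rightarrow> real)"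
  shows "AE \<omega> in M. (\<lambda>n. (\<Sum>k<n. f (X (real (Suc k) * \<delta>) \<omega>)
    - (LINT y|K \<delta> (X (real k * \<delta>) \<omega>). f y)) / real n) \<longlonglongrightarrow> 0"
proof (rule strong_law_orthogonal)
  define g where "g x = (LINT y|K \<delta> x. f y)" for x
  have g: "continuous_on UNIV g"
    unfolding g_def using continuous_transition[of \<delta> f] f \<delta> by simp
  define U where "U k \<omega> = f (X (real (Suc k) * \<delta>) \<omega>) - g (X (real k * \<delta>) \<omega>)" for k \<omega>
  define B where "B = 2 * norm (Bcontfun f)"
  have st: "0 \<le> real k * \<delta>" "real k * \<delta> < real (Suc k) * \<delta>" "real k * \<delta> + \<delta> = real (Suc k) * \<delta>" for k
    using \<delta> by (simp_all add: algebra_simps)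
  have U_meas: "U k \<in> borel_measurable (F (real (Suc k) * \<delta>))" for k
    unfolding U_def[abs_def]
    using continuous_X_measurable[OF st(1)[of "Suc k"] f]
      measurable_F_mono[OF continuous_X_measurable[OF st(1)[of k] g] less_imp_le[OF st(2)]]
    by measurable
  show meas: "U k \<in> borel_measurable M" for k
    by (rule measurable_F_M[OF U_meas])
  have f_le: "\<bar>f x\<bar> \<le> norm (Bcontfun f)" for x
    using norm_bounded[of "Bcontfun f" x] f by simp
  have g_le: "\<bar>g x\<bar> \<le> norm (Bcontfun f)" for x
    using config_integral_le_norm[OF kernel_distribution[OF less_imp_le[OF \<delta>]], of x "Bcontfun f"] f
    by (simp add: g_def)
  have U_le: "\<bar>U k \<omega>\<bar> \<le> B" for k \<omega>
    using f_le[of "X (real (Suc k) * \<delta>) \<omega>"] g_le[of "X (real k * \<delta>) \<omega>"]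
    unfolding U_def B_def by linarith
  have U2_le: "(U k \<omega>)\<^sup>2 \<le> B\<^sup>2" for k \<omega>
    using power_mono[OF U_le, of k \<omega> 2] by simp
  show U2: "integrable M (\<lambda>\<omega>. (U k \<omega>)\<^sup>2)" for k
    using meas[of k] U2_le by (intro integrable_const_bound[where B = "B\<^sup>2"]) auto
  show "expectation (\<lambda>\<omega>. (U k \<omega>)\<^sup>2) \<le> B\<^sup>2" for k
    using integral_mono[OF U2 integrable_const U2_le] by (simp add: prob_space)
  fix j k :: nat assume "j < k"
  then have "real (Suc j) * \<delta> \<le> real k * \<delta>"
    using \<delta> by (intro mult_right_mono) auto
  then have V: "U j \<in> borel_measurable (F (real k * \<delta>))"
    using measurable_F_mono[OF U_meas] by blast
  have f_meas: "(\<lambda>\<omega>. f (X (real (Suc k) * \<delta>) \<omega>)) \<in> borel_measurable M"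
    by (rule measurable_F_M[OF continuous_X_measurable[OF st(1) f]])
  have g_meas: "(\<lambda>\<omega>. g (X (real k * \<delta>) \<omega>)) \<in> borel_measurable M"
    by (rule measurable_F_M[OF continuous_X_measurable[OF st(1) g]])
  have int: "integrable M (\<lambda>\<omega>. U j \<omega> * f (X (real (Suc k) * \<delta>) \<omega>))"
  proof (rule integrable_const_bound[where B = "B * norm (Bcontfun f)"])
    show "AE \<omega> in M. norm (U j \<omega> * f (X (real (Suc k) * \<delta>) \<omega>)) \<le> B * norm (Bcontfun f)"
      using U_le f_le by (auto simp: abs_mult intro!: mult_mono order_trans[OF abs_ge_zero U_le])
  qed (use meas[of j] f_meas in measurable)
  have "AE \<omega> in M. real_cond_exp M (F (real k * \<delta>)) (\<lambda>\<omega>. f (X (real (Suc k) * \<delta>) \<omega>)) \<omega> = g (X (real k * \<delta>) \<omega>)"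
    using markov[OF st(1) less_imp_le[OF \<delta>], of k "Bcontfun f"]
    unfolding apply_Bcontfun_config[OF f] st(3) g_def .
  note ce = subalgebra_cond_exp[OF filtration_sub V f_meas int this g_meas]
  have "expectation (\<lambda>\<omega>. U j \<omega> * U k \<omega>) =
      expectation (\<lambda>\<omega>. U j \<omega> * f (X (real (Suc k) * \<delta>) \<omega>) - U j \<omega> * g (X (real k * \<delta>) \<omega>))"
    by (simp add: U_def[of k] right_diff_distrib)
  also have "\<dots> = 0"
    using ce int by simp
  finally show "expectation (\<lambda>\<omega>. U j \<omega> * U k \<omega>) = 0" .
qed

text \<open>The Markov chain \<open>X\<^bsub>k\<delta>\<^esub>\<close> has the same time averages of \<open>f\<close> and \<open>K\<^sub>\<delta> f\<close>,
  hence of \<open>f\<close> and of its Cesaro means, which are uniformly close to \<open>\<integral> f d\<pi>\<close>.\<close>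

lemma strong_law_skeleton:
  assumes \<delta>: "0 < \<delta>" and f: "continuous_on UNIV (f :: config \<Rightarrow> real)"
  shows "AE \<omega> in M. (\<lambda>n. (\<Sum>k<n. f (X (real k * \<delta>) \<omega>)) / real n) \<longlonglongrightarrow> (LINT x|\<pi>. f x)"
proof -
  define P where "P j x = (LINT y|K (real j * \<delta>) x. f y)" for j x
  have \<delta>j: "0 \<le> real j * \<delta>" for j using \<delta> by simp
  have P: "continuous_on UNIV (P j)" for j
    unfolding P_def by (rule continuous_transition[OF \<delta>j f])
  have P0: "P 0 = f"
    using integral_start[OF f] by (simp add: P_def fun_eq_iff)
  have P_Suc: "(LINT y|K \<delta> x. P j y) = P (Suc j) x" for j x
    using transition_add[OF less_imp_le[OF \<delta>] \<delta>j[of j] f, of x] by (simp add: P_def algebra_simps)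
  define A where "A j n \<omega> = (\<Sum>k<n. P j (X (real k * \<delta>) \<omega>)) / real n" for j n \<omega>
  have "AE \<omega> in M. \<forall>j. (\<lambda>n. (\<Sum>k<n. P j (X (real (Suc k) * \<delta>) \<omega>)
    - P (Suc j) (X (real k * \<delta>) \<omega>)) / real n) \<longlonglongrightarrow> 0"
    unfolding AE_all_countable using strong_law_Markov_step[OF \<delta> P] by (simp only: P_Suc simp_thms)
  then show ?thesis
  proof eventually_elim
    case (elim \<omega>)
    have step: "(\<lambda>n. A j n \<omega> - A (Suc j) n \<omega>) \<longlonglongrightarrow> 0" for j
    proof -
      let ?a = "\<lambda>k. P j (X (real k * \<delta>) \<omega>)"
      \<comment> \<open>The Markov step law compares the value at index \<open>Suc k\<close> with a
        prediction made at index k; realigning the sum costs only its two end terms divided by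
        n.\<close>
      have eq: "A j n \<omega> - A (Suc j) n \<omega> = (\<Sum>k<n. ?a (Suc k) - P (Suc j) (X (real k * \<delta>) \<omega>)) / real n
          - (?a n - ?a 0) / real n" for n
      proof -
        have "(\<Sum>k<n. ?a (Suc k) - ?a k) = ?a n - ?a 0" by (rule sum_lessThan_telescope)
        then have "(\<Sum>k<n. ?a k) - (\<Sum>k<n. P (Suc j) (X (real k * \<delta>) \<omega>)) =
            (\<Sum>k<n. ?a (Suc k) - P (Suc j) (X (real k * \<delta>) \<omega>)) - (?a n - ?a 0)"
          unfolding sum_subtractf by linarith
        then show ?thesis unfolding A_def by (simp only: diff_divide_distrib[symmetric])
      qed
      have "(\<lambda>n. (?a n - ?a 0) / real n) \<longlonglongrightarrow> 0"
      proof (rule Lim_null_comparison[OF always_eventually])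
        show "\<forall>n. norm ((?a n - ?a 0) / real n) \<le> 2 * norm (Bcontfun (P j)) / real n"
        proof
          fix n
          have "\<bar>?a n - ?a 0\<bar> \<le> 2 * norm (Bcontfun (P j))"
            using norm_bounded[of "Bcontfun (P j)" "X (real n * \<delta>) \<omega>"]
              norm_bounded[of "Bcontfun (P j)" "X (real 0 * \<delta>) \<omega>"]
            unfolding apply_Bcontfun_config[OF P] real_norm_def by linarith
          then show "norm ((?a n - ?a 0) / real n) \<le> 2 * norm (Bcontfun (P j)) / real n"
            by (simp add: divide_right_mono)
        qed
        show "(\<lambda>n. 2 * norm (Bcontfun (P j)) / real n) \<longlonglongrightarrow> 0" by (rule lim_const_over_n)
      qed
      from tendsto_diff[OF elim[rule_format, of j] this] show ?thesis
        unfolding eq by simp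
    qed
    have diff: "(\<lambda>n. A 0 n \<omega> - A j n \<omega>) \<longlonglongrightarrow> 0" for j
    proof (induction j)
      case (Suc j)
      from tendsto_add[OF Suc step[of j]] show ?case by simp
    qed simp
    have "(\<lambda>n. A 0 n \<omega>) \<longlonglongrightarrow> (LINT x|\<pi>. f x)"
    proof (rule LIMSEQ_I)
      fix e :: real assume "0 < e"
      then have "0 < e / 2" by simp
      \<comment> \<open>m is chosen before n and regardless of the path: every state then
        contributes a Cesaro mean within \<open>e / 2\<close> of the limit.\<close>
      from uniform_Cesaro[OF ergodic f \<delta> this] obtain m where m: "0 < m"
        "\<And>x. \<bar>(\<Sum>j<m. P j x) / real m - (LINT x|\<pi>. f x)\<bar> \<le> e / 2"
        unfolding P_def by blast
      have "(\<lambda>n. (\<Sum>j<m. A 0 n \<omega> - A j n \<omega>) / real m) \<longlonglongrightarrow> (\<Sum>j<m. 0) / real m"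
        by (intro tendsto_divide tendsto_sum diff tendsto_const) (use m(1) in simp)
      then have "(\<lambda>n. (\<Sum>j<m. A 0 n \<omega> - A j n \<omega>) / real m) \<longlonglongrightarrow> 0" by simp
      from LIMSEQ_D[OF this \<open>0 < e / 2\<close>] obtain n0 where
        n0: "\<And>n. n0 \<le> n \<Longrightarrow> \<bar>(\<Sum>j<m. A 0 n \<omega> - A j n \<omega>) / real m\<bar> < e / 2"
        by auto
      \<comment> \<open>The index 0 is excluded because division by \<open>real 0\<close> yields
        0.\<close>
      show "\<exists>n0. \<forall>n\<ge>n0. norm (A 0 n \<omega> - (LINT x|\<pi>. f x)) < e"
      proof (intro exI[of _ "max 1 n0"] allI impI)
        fix n assume n: "max 1 n0 \<le> n"
        have "(\<Sum>j<m. A j n \<omega>) / real m = (\<Sum>k<n. (\<Sum>j<m. P j (X (real k * \<delta>) \<omega>)) / real m) / real n"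
          unfolding A_def sum_divide_distrib[symmetric] by (subst sum.swap) simp
        moreover have "\<bar>(\<Sum>k<n. (\<Sum>j<m. P j (X (real k * \<delta>) \<omega>)) / real m) / real n - (LINT x|\<pi>. f x)\<bar> \<le> e / 2"
        proof -
          have "\<bar>\<Sum>k<n. (\<Sum>j<m. P j (X (real k * \<delta>) \<omega>)) / real m - (LINT x|\<pi>. f x)\<bar> \<le> (\<Sum>k<n. e / 2)"
            by (rule order_trans[OF sum_abs sum_mono]) (rule m(2))
          then have "\<bar>\<Sum>k<n. (\<Sum>j<m. P j (X (real k * \<delta>) \<omega>)) / real m - (LINT x|\<pi>. f x)\<bar> / real n \<le> e / 2"
            using n by (simp add: field_simps)
          moreover have "(\<Sum>k<n. (\<Sum>j<m. P j (X (real k * \<delta>) \<omega>)) / real m) / real n - (LINT x|\<pi>. f x)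
              = (\<Sum>k<n. (\<Sum>j<m. P j (X (real k * \<delta>) \<omega>)) / real m - (LINT x|\<pi>. f x)) / real n"
            using n by (simp add: sum_subtractf diff_divide_distrib)
          ultimately show ?thesis by simp
        qed
        moreover have "(\<Sum>j<m. A 0 n \<omega> - A j n \<omega>) / real m = A 0 n \<omega> - (\<Sum>j<m. A j n \<omega>) / real m"
          using m(1) by (simp add: sum_subtractf diff_divide_distrib)
        ultimately show "norm (A 0 n \<omega> - (LINT x|\<pi>. f x)) < e"
          using n0[of n] n unfolding real_norm_def by linarith
      qed
    qed
    then show ?case by (simp add: A_def P0)
  qed
qed

end

section \<open>Outcomes of plays relative to the strict past\<close>

context spin_play
begin

definition win :: "int \<Rightarrow> nat \<Rightarrow> 'w \<Rightarrow> real" where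
  "win i n = indicator {\<omega> \<in> space M. X (T i n \<omega>) \<omega> i}"

lemma T_measurable: "T i n \<in> borel_measurable M"
  by (rule measurable_stopping_time[OF play_stopping_time])
    (use filtration_sub in \<open>auto simp: subalgebra_def\<close>)

lemma subalgebra_strict_past: "subalgebra M (strict_past M F (T i n))"
proof -
  have T [measurable]: "T i n \<in> borel_measurable M" by (rule T_measurable)
  have sub: "sets (F t) \<subseteq> sets M" for t using filtration_sub by (auto simp: subalgebra_def)
  have "A \<inter> {\<omega> \<in> space M. t < T i n \<omega>} \<in> sets M" if "A \<in> sets (F t)" for A t
    using that sub by (intro sets.Int) auto
  then have "sets (F 0) \<union> {A \<inter> {\<omega> \<in> space M. t < T i n \<omega>} |A t. 0 \<le> t \<and> A \<in> sets (F t)} \<subseteq> sets M"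
    using sub by auto
  then show ?thesis
    unfolding subalgebra_def strict_past_def
    by (simp add: sets.sigma_sets_subset sets.space_closed subset_trans[OF _ sets.space_closed] space_measure_of_conv)
qed

lemma sets_strict_pastI:
  assumes "0 \<le> t" "A \<in> sets (F t)"
  shows "A \<inter> {\<omega> \<in> space M. t < T i n \<omega>} \<in> sets (strict_past M F (T i n))"
proof -
  have "sets (F 0) \<union> {A \<inter> {\<omega> \<in> space M. t < T i n \<omega>} |A t. 0 \<le> t \<and> A \<in> sets (F t)} \<subseteq> Pow (space M)"
    using sets.space_closed[of "F _"] by (auto simp: space_F)
  then show ?thesis
    unfolding strict_past_def using assms by (auto intro: in_measure_of)
qed

text \<open>Since play j comes no later than play n, a generator for j can be intersected with
  \<open>t < T i n \<omega>\<close> at no loss. What remains, A with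
  \<open>t < T i j \<omega>\<close>, lies in \<open>F t\<close> because play times are stopping
  times.\<close>

lemma strict_past_mono:
  assumes "j \<le> n"
  shows "subalgebra (strict_past M F (T i n)) (strict_past M F (T i j))"
proof -
  have le: "T i j \<omega> \<le> T i n \<omega>" if "\<omega> \<in> space M" for \<omega>
    using strict_mono_less_eq[OF play_times(2)[OF that]] assms by blast
  let ?G = "\<lambda>n. sets (F 0) \<union> {A \<inter> {\<omega> \<in> space M. t < T i n \<omega>} |A t. 0 \<le> t \<and> A \<in> sets (F t)}"
  have Pow: "?G n \<subseteq> Pow (space M)" for n
    using sets.space_closed[of "F _"] by (auto simp: space_F)
  have "A \<inter> {\<omega> \<in> space M. t < T i j \<omega>} \<in> sets (strict_past M F (T i n))"
    if "0 \<le> t" "A \<in> sets (F t)" for A t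
  proof -
    have "A \<inter> {\<omega> \<in> space (F t). t < T i j \<omega>} \<in> sets (F t)"
      using that(2) stopping_timeD2[OF play_stopping_time, of t i j]
      by (intro sets.Int) (auto simp: pred_def)
    from sets_strict_pastI[OF that(1) this, of i n]
    have "A \<inter> {\<omega> \<in> space (F t). t < T i j \<omega>} \<inter> {\<omega> \<in> space M. t < T i n \<omega>} \<in> sets (strict_past M F (T i n))" .
    also have "A \<inter> {\<omega> \<in> space (F t). t < T i j \<omega>} \<inter> {\<omega> \<in> space M. t < T i n \<omega>} = A \<inter> {\<omega> \<in> space M. t < T i j \<omega>}"
      using le by (force simp: space_F)
    finally show ?thesis .
  qed
  moreover have "sets (F 0) \<subseteq> sets (strict_past M F (T i n))"
    unfolding strict_past_def using Pow[of n] by (auto intro: in_measure_of)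
  ultimately have "?G j \<subseteq> sets (strict_past M F (T i n))" by blast
  then have "sigma_sets (space (strict_past M F (T i n))) (?G j) \<subseteq> sets (strict_past M F (T i n))"
    by (rule sets.sigma_sets_subset)
  then show ?thesis
    unfolding subalgebra_def using Pow[of j] Pow[of n]
    by (simp add: strict_past_def space_measure_of_conv)
qed

text \<open>The outcome of play \<open>j\<close> can be read off at a rational time between plays \<open>j\<close> and \<open>j + 1\<close>.\<close>

lemma win_measurable_strict_past:
  assumes "j < n"
  shows "win i j \<in> borel_measurable (strict_past M F (T i n))"
proof -
  let ?B = "\<lambda>q. {\<omega> \<in> space (F q). T i j \<omega> \<le> q \<and> q < T i (Suc j) \<omega> \<and> X q \<omega> i}"
  \<comment> \<open>Any q before play \<open>Suc j\<close> is also before play n, so each piece lies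
    in the strict past of play n; rational q keep the union countable.\<close>
  have "{\<omega> \<in> space M. X (T i j \<omega>) \<omega> i} = (\<Union>q\<in>{q \<in> \<rat>. 0 \<le> q}. ?B q \<inter> {\<omega> \<in> space M. q < T i n \<omega>})"
  proof (intro set_eqI iffI)
    fix \<omega> assume \<omega>: "\<omega> \<in> {\<omega> \<in> space M. X (T i j \<omega>) \<omega> i}"
    note T = play_times(2)[of \<omega> i, THEN strict_mono_less_eq] play_times(2)[of \<omega> i, THEN strict_mono_less]
    have pos: "0 < T i j \<omega>"
      using play_times(1)[of \<omega> i] T(1)[of 0 j] \<omega> by auto
    obtain q where q: "q \<in> \<rat>" "T i j \<omega> < q" "q < T i (Suc j) \<omega>"
      using Rats_dense_in_real[of "T i j \<omega>" "T i (Suc j) \<omega>"] T(2)[of j "Suc j"] \<omega> by auto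
    have "T i m \<omega> \<notin> {T i j \<omega><..q}" for m
    proof
      assume "T i m \<omega> \<in> {T i j \<omega><..q}"
      then have "T i j \<omega> < T i m \<omega>" "T i m \<omega> < T i (Suc j) \<omega>" using q(3) by auto
      then show False using T(2)[of j m] T(2)[of m "Suc j"] \<omega> by auto
    qed
    then have "X q \<omega> i = X (T i j \<omega>) \<omega> i"
      using \<omega> pos q(2) by (intro constant_between_plays) auto
    moreover have "q < T i n \<omega>"
      using q(3) T(1)[of "Suc j" n] assms \<omega> by auto
    ultimately show "\<omega> \<in> (\<Union>q\<in>{q \<in> \<rat>. 0 \<le> q}. ?B q \<inter> {\<omega> \<in> space M. q < T i n \<omega>})"
      using \<omega> q pos by (auto simp: space_F intro!: bexI[of _ q])
  next
    fix \<omega> assume "\<omega> \<in> (\<Union>q\<in>{q \<in> \<rat>. 0 \<le> q}. ?B q \<inter> {\<omega> \<in> space M. q < T i n \<omega>})"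
    then obtain q where q: "0 \<le> q" "\<omega> \<in> space M" "T i j \<omega> \<le> q" "q < T i (Suc j) \<omega>" "X q \<omega> i"
      by auto
    note T = play_times(2)[OF q(2), of i, THEN strict_mono_less_eq] play_times(2)[OF q(2), of i, THEN strict_mono_less]
    have pos: "0 \<le> T i j \<omega>"
      using play_times(1)[OF q(2), of i] T(1)[of 0 j] by auto
    have "T i m \<omega> \<notin> {T i j \<omega><..q}" for m
    proof
      assume "T i m \<omega> \<in> {T i j \<omega><..q}"
      then have "T i j \<omega> < T i m \<omega>" "T i m \<omega> < T i (Suc j) \<omega>" using q(4) by auto
      then show False using T(2)[of j m] T(2)[of m "Suc j"] by auto
    qed
    then have "X q \<omega> i = X (T i j \<omega>) \<omega> i"
      using pos q by (intro constant_between_plays) auto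
    then show "\<omega> \<in> {\<omega> \<in> space M. X (T i j \<omega>) \<omega> i}" using q by simp
  qed
  also have "\<dots> \<in> sets (strict_past M F (T i n))"
  proof (rule sets.countable_UN'')
    show "countable {q \<in> \<rat>. 0 \<le> (q :: real)}"
      by (rule countable_subset[OF _ countable_rat]) auto
    fix q :: real assume "q \<in> {q \<in> \<rat>. 0 \<le> q}"
    then have q: "0 \<le> q" by simp
    have "open {x :: config. x i}"
      using open_cylinder[of "{i}" "\<lambda>_. True"] by simp
    then have "Measurable.pred borel (\<lambda>x :: config. x i)"
      by (simp add: pred_def)
    from measurable_compose[OF adapted[OF q] this]
    have [measurable]: "Measurable.pred (F q) (\<lambda>\<omega>. X q \<omega> i)" .
    have [measurable]: "Measurable.pred (F q) (\<lambda>\<omega>. T i j \<omega> \<le> q)" "Measurable.pred (F q) (\<lambda>\<omega>. q < T i (Suc j) \<omega>)"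
      using stopping_timeD[OF play_stopping_time] stopping_timeD2[OF play_stopping_time] by auto
    have "?B q \<in> sets (F q)" by measurable
    then show "?B q \<inter> {\<omega> \<in> space M. q < T i n \<omega>} \<in> sets (strict_past M F (T i n))"
      by (rule sets_strict_pastI[OF q])
  qed
  finally show ?thesis unfolding win_def by simp
qed

lemma win_measurable: "win i n \<in> borel_measurable M"
  by (rule measurable_from_subalg[OF subalgebra_strict_past win_measurable_strict_past[of n "Suc n"]]) simp

text \<open>The centred outcomes are orthogonal because an earlier one is known in the strict past
  of a later play.\<close>

lemma strong_law_win:
  "AE \<omega> in M. (\<lambda>n. (\<Sum>k<n. win i k \<omega> - p (nbhd i (state_before X (T i k \<omega>) \<omega>))) / real n) \<longlonglongrightarrow> 0"
proof -
  \<comment> \<open>The abstract conditional expectation is centred first, as its measurability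
    comes for free; the explicit probability involves left limits of the path and is substituted
    only at the end, almost everywhere.\<close>
  define R where "R n = real_cond_exp M (strict_past M F (T i n)) (win i n)" for n
  define D where "D n \<omega> = win i n \<omega> - R n \<omega>" for n \<omega>
  have win01: "0 \<le> win i n \<omega>" "win i n \<omega> \<le> 1" for n \<omega>
    by (auto simp: win_def indicator_def)
  have win_int: "integrable M (win i n)" for n
    using win01 win_measurable by (intro integrable_const_bound[where B = 1]) auto
  have R_meas: "R n \<in> borel_measurable (strict_past M F (T i n))" for n
    unfolding R_def by (rule borel_measurable_cond_exp)
  have R_meas_M: "R n \<in> borel_measurable M" for n
    unfolding R_def by (rule borel_measurable_cond_exp2)
  have R01: "AE \<omega> in M. 0 \<le> R n \<omega> \<and> R n \<omega> \<le> 1" for n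
  proof -
    interpret finite_measure_subalgebra M "strict_past M F (T i n)"
      by unfold_locales (rule subalgebra_strict_past)
    show ?thesis
      unfolding R_def
      by (intro AE_conjI real_cond_exp_ge_c[OF win_int] real_cond_exp_le_c[OF win_int]) (simp_all add: win01)
  qed
  have D_meas: "D n \<in> borel_measurable M" for n
    unfolding D_def[abs_def] using win_measurable R_meas_M by measurable
  have D1: "AE \<omega> in M. \<bar>D n \<omega>\<bar> \<le> 1" for n
    using R01[of n]
  proof eventually_elim
    case (elim \<omega>)
    then show ?case using win01[of n \<omega>] unfolding D_def by linarith
  qed
  have D2: "AE \<omega> in M. (D n \<omega>)\<^sup>2 \<le> 1" for n
    using D1[of n] by eventually_elim (simp add: abs_square_le_1)
  have int_D2: "integrable M (\<lambda>\<omega>. (D n \<omega>)\<^sup>2)" for n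
    using D_meas D2[of n] by (intro integrable_const_bound[where B = 1]) auto
  have "AE \<omega> in M. (\<lambda>n. (\<Sum>k<n. D k \<omega>) / real n) \<longlonglongrightarrow> 0"
  proof (rule strong_law_orthogonal[OF D_meas int_D2, where C = 1])
    show "expectation (\<lambda>\<omega>. (D n \<omega>)\<^sup>2) \<le> 1" for n
      using integral_mono_AE[OF int_D2 integrable_const D2] by (simp add: prob_space)
    fix j n :: nat assume "j < n"
    have V: "D j \<in> borel_measurable (strict_past M F (T i n))"
      unfolding D_def[abs_def]
      using win_measurable_strict_past[OF \<open>j < n\<close>]
        measurable_from_subalg[OF strict_past_mono[OF less_imp_le[OF \<open>j < n\<close>]] R_meas]
      by measurable
    have int: "integrable M (\<lambda>\<omega>. D j \<omega> * win i n \<omega>)"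
    proof (rule integrable_const_bound[where B = 1])
      show "AE \<omega> in M. norm (D j \<omega> * win i n \<omega>) \<le> 1"
        using D1[of j]
      proof eventually_elim
        case (elim \<omega>)
        then have "\<bar>D j \<omega>\<bar> * win i n \<omega> \<le> 1 * 1"
          using win01[of n \<omega>] by (intro mult_mono) auto
        then show ?case using win01[of n \<omega>] by (simp add: abs_mult)
      qed
    qed (use D_meas win_measurable in measurable)
    note ce = subalgebra_cond_exp[OF subalgebra_strict_past V win_measurable int _ R_meas_M]
    have eq: "AE \<omega> in M. real_cond_exp M (strict_past M F (T i n)) (win i n) \<omega> = R n \<omega>"
      by (simp add: R_def)
    have "expectation (\<lambda>\<omega>. D j \<omega> * D n \<omega>) = expectation (\<lambda>\<omega>. D j \<omega> * win i n \<omega> - D j \<omega> * R n \<omega>)"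
      by (simp add: D_def[of n] right_diff_distrib)
    also have "\<dots> = 0"
      using ce[OF eq] int by simp
    finally show "expectation (\<lambda>\<omega>. D j \<omega> * D n \<omega>) = 0" .
  qed
  moreover have "AE \<omega> in M. \<forall>n. R n \<omega> = p (nbhd i (state_before X (T i n \<omega>) \<omega>))"
    unfolding AE_all_countable R_def win_def using win_probability by blast
  ultimately show ?thesis
    by eventually_elim (simp add: D_def)
qed

end

section \<open>The profit of player 0\<close>

text \<open>Monotonicity squeezes \<open>R t\<close> between its values at neighbouring grid points.
  The grid error there is about \<open>3 * \<delta> * t\<close>, which becomes
  \<open>3 * \<delta>\<close> after division by t, and \<delta> runs through the countable family
  \<open>1 / real (Suc r)\<close>.\<close>

lemma mono_growth_rate:
  fixes R :: "real \<Rightarrow> real"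
  assumes mono: "\<And>s t. 0 \<le> s \<Longrightarrow> s \<le> t \<Longrightarrow> R s \<le> R t" and c: "0 \<le> c"
    and grid: "\<And>r. eventually (\<lambda>k. \<bar>R (real k * (1 / real (Suc r))) - c * (real k * (1 / real (Suc r)))\<bar>
      \<le> 3 * (1 / real (Suc r))\<^sup>2 * real k) sequentially"
  shows "((\<lambda>t. R t / t) \<longlongrightarrow> c) at_top"
proof (rule tendstoI)
  fix e :: real assume e: "0 < e"
  obtain r :: nat where r: "6 / e < real r" using reals_Archimedean2 by blast
  define \<delta> where "\<delta> = 1 / real (Suc r)"
  have \<delta>: "0 < \<delta>" by (simp add: \<delta>_def)
  have "6 < e * real (Suc r)" using r e by (simp add: field_simps)
  then have \<delta>_small: "3 * \<delta> < e / 2" by (simp add: \<delta>_def field_simps)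
  obtain k0 where k0: "\<And>k. k0 \<le> k \<Longrightarrow> \<bar>R (real k * \<delta>) - c * (real k * \<delta>)\<bar> \<le> 3 * \<delta>\<^sup>2 * real k"
    using grid[of r] unfolding eventually_sequentially \<delta>_def by blast
  \<comment> \<open>The first bound puts t beyond grid point k0; the second makes the error
    \<open>(c + 3 * \<delta>) * \<delta>\<close> from rounding t to the grid smaller than
    \<open>e / 2 * t\<close>.\<close>
  define t0 where "t0 = max (real (Suc k0) * \<delta>) (2 * (c + 3 * \<delta>) * \<delta> / e)"
  have "dist (R t / t) c < e" if t: "t0 < t" for t
  proof -
    have t1: "real (Suc k0) * \<delta> < t" "2 * (c + 3 * \<delta>) * \<delta> / e < t" using t by (auto simp: t0_def)
    have "0 < real (Suc k0) * \<delta>" using \<delta> by simp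
    then have t_pos: "0 < t" using t1(1) by linarith
    define k where "k = nat \<lfloor>t / \<delta>\<rfloor>"
    have "0 \<le> t / \<delta>" using t_pos \<delta> by simp
    then have "real k \<le> t / \<delta>" "t / \<delta> < real (Suc k)"
      unfolding k_def by linarith+
    then have k: "real k * \<delta> \<le> t" "t < real (Suc k) * \<delta>"
      using \<delta> by (simp_all add: field_simps)
    have "real (Suc k0) * \<delta> < real (Suc k) * \<delta>" using t1(1) k(2) by linarith
    then have "k0 \<le> k" using \<delta> by simp
    have k\<delta>: "real (Suc k) * \<delta> \<le> t + \<delta>" using k(1) by (simp add: distrib_right)
    have "R t \<le> R (real (Suc k) * \<delta>)" using t_pos k(2) by (intro mono) auto
    also have "\<dots> \<le> c * (real (Suc k) * \<delta>) + 3 * \<delta>\<^sup>2 * real (Suc k)"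
      using k0[of "Suc k"] \<open>k0 \<le> k\<close> by linarith
    also have "\<dots> = (c + 3 * \<delta>) * (real (Suc k) * \<delta>)"
      by (simp add: power2_eq_square algebra_simps)
    also have "\<dots> \<le> (c + 3 * \<delta>) * (t + \<delta>)"
      using k\<delta> c \<delta> by (intro mult_left_mono) auto
    finally have upper: "R t - c * t \<le> 3 * \<delta> * t + (c + 3 * \<delta>) * \<delta>"
      by (simp add: algebra_simps)
    have "c * (t - \<delta>) \<le> c * (real k * \<delta>)"
      using k(2) c by (intro mult_left_mono) (simp_all add: distrib_right)
    moreover have "3 * \<delta>\<^sup>2 * real k \<le> 3 * \<delta> * t"
      using mult_left_mono[OF k(1), of "3 * \<delta>"] \<delta> by (simp add: power2_eq_square algebra_simps)
    moreover have "R (real k * \<delta>) \<le> R t" using \<delta> k(1) by (intro mono) auto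
    moreover have "c * (real k * \<delta>) - 3 * \<delta>\<^sup>2 * real k \<le> R (real k * \<delta>)"
      using k0[OF \<open>k0 \<le> k\<close>] by linarith
    moreover have "c * (t - \<delta>) = c * t - c * \<delta>" "(c + 3 * \<delta>) * \<delta> = c * \<delta> + 3 * \<delta> * \<delta>"
      by (simp_all only: right_diff_distrib distrib_right)
    moreover have "0 \<le> 3 * \<delta> * \<delta>" using \<delta> by simp
    ultimately have lower: "- (3 * \<delta> * t + (c + 3 * \<delta>) * \<delta>) \<le> R t - c * t"
      by linarith
    have "(c + 3 * \<delta>) * \<delta> < e / 2 * t" using t1(2) e by (simp add: field_simps)
    moreover have "3 * \<delta> * t < e / 2 * t" using \<delta>_small t_pos by simp
    ultimately have "\<bar>R t - c * t\<bar> < e * t" using upper lower by (simp add: abs_less_iff)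
    moreover have "R t / t - c = (R t - c * t) / t" using t_pos by (simp add: field_simps)
    ultimately show ?thesis using t_pos by (simp add: dist_real_def abs_divide divide_less_eq)
  qed
  then show "eventually (\<lambda>t. dist (R t / t) c < e) at_top"
    unfolding eventually_at_top_dense by blast
qed

lemma nbhd_le_3: "nbhd i x \<le> 3"
  by (simp add: nbhd_def status_def)

context spin_play
begin

lemma increment_0_no_play:
  assumes "\<omega> \<in> space M" "increment j s t \<omega> = 0"
  shows "T j m \<omega> \<notin> {s<..t}"
  using assms(2) num_plays_less_iff[OF assms(1), of m j t] num_plays_less_iff[OF assms(1), of m j s]
  by (auto simp: increment_def)

text \<open>Without a play in the interval the coordinate is constant on it, hence so is its left
  limit. \<tau> must exceed s strictly, so that times just before \<tau> lie in the
  interval.\<close>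

lemma state_before_eq:
  assumes \<omega>: "\<omega> \<in> space M" and inc: "increment j s t \<omega> = 0" and s: "0 \<le> s" "s < \<tau>" "\<tau> \<le> t"
  shows "state_before X \<tau> \<omega> j = X s \<omega> j"
proof -
  have "X u \<omega> j = X s \<omega> j" if "s < u" "u < \<tau>" for u
    using increment_0_no_play[OF \<omega> inc] that s by (intro constant_between_plays[OF \<omega>]) fastforce+
  then have "eventually (\<lambda>u. X u \<omega> j = X s \<omega> j) (at_left \<tau>)"
    unfolding eventually_at_left_field using s(2) by blast
  then have "((\<lambda>u. X u \<omega> j) \<longlongrightarrow> X s \<omega> j) (at_left \<tau>)"
    by (rule tendsto_eventually)
  then show ?thesis
    unfolding state_before_def by (intro tendsto_Lim trivial_limit_at_left_real)
qed

end

section \<open>Chances seen by player 0, and passage to continuous time\<close>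

context ergodic_spin_play
begin

definition chance :: "nat \<Rightarrow> 'w \<Rightarrow> real" where
  "chance n \<omega> = p (nbhd 0 (state_before X (T 0 n \<omega>) \<omega>))"

lemma chance_01: "0 \<le> chance n \<omega>" "chance n \<omega> \<le> 1"
  using p01[OF nbhd_le_3] by (auto simp: chance_def)

text \<open>If neither neighbour plays, every chance equals the one at time s, as the player's own
  status does not enter it. Otherwise the difference of two probabilities is at most 1, hence at
  most the neighbours' count. Counts are used instead of an indicator since products of independent
  counts have explicit means.\<close>

lemma chances_in_interval:
  assumes \<omega>: "\<omega> \<in> space M" and st: "0 \<le> s" "s < t"
  shows "\<bar>(\<Sum>n = num_plays T 0 s \<omega>..<num_plays T 0 t \<omega>. chance n \<omega>)
      - real (increment 0 s t \<omega>) * p (nbhd 0 (X s \<omega>))\<bar>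
    \<le> real (increment 0 s t \<omega>) * (real (increment (- 1) s t \<omega>) + real (increment 1 s t \<omega>))"
proof -
  let ?I = "{num_plays T 0 s \<omega>..<num_plays T 0 t \<omega>}"
  let ?B = "real (increment (- 1) s t \<omega>) + real (increment 1 s t \<omega>)"
  have le: "\<bar>chance n \<omega> - p (nbhd 0 (X s \<omega>))\<bar> \<le> ?B" if "n \<in> ?I" for n
  proof (cases "increment (- 1) s t \<omega> = 0 \<and> increment 1 s t \<omega> = 0")
    case True
    have T: "s < T 0 n \<omega>" "T 0 n \<omega> \<le> t"
      using that num_plays_less_iff[OF \<omega>, of n 0 s] num_plays_less_iff[OF \<omega>, of n 0 t] by auto
    have "state_before X (T 0 n \<omega>) \<omega> (- 1) = X s \<omega> (- 1)"
      by (rule state_before_eq[OF \<omega> conjunct1[OF True] st(1) T])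
    moreover have "state_before X (T 0 n \<omega>) \<omega> 1 = X s \<omega> 1"
      by (rule state_before_eq[OF \<omega> conjunct2[OF True] st(1) T])
    ultimately have "chance n \<omega> = p (nbhd 0 (X s \<omega>))"
      by (simp add: chance_def nbhd_def status_def)
    then show ?thesis by simp
  next
    case False
    then have "1 \<le> increment (- 1) s t \<omega> + increment 1 s t \<omega>" by auto
    then have "1 \<le> ?B" by (simp flip: of_nat_add)
    moreover have "0 \<le> p (nbhd 0 (X s \<omega>))" "p (nbhd 0 (X s \<omega>)) \<le> 1"
      using p01[OF nbhd_le_3] by auto
    ultimately show ?thesis using chance_01[of n \<omega>] by linarith
  qed
  have card: "real (increment 0 s t \<omega>) = real (card ?I)"
    by (simp add: increment_def)
  have "\<bar>\<Sum>n\<in>?I. chance n \<omega> - p (nbhd 0 (X s \<omega>))\<bar> \<le> (\<Sum>n\<in>?I. ?B)"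
    by (rule order_trans[OF sum_abs sum_mono]) (rule le)
  then show ?thesis unfolding sum_subtractf sum_constant card .
qed

lemma num_plays_sum:
  assumes \<omega>: "\<omega> \<in> space M" and \<delta>: "0 < \<delta>"
  shows "(\<Sum>n<num_plays T 0 (real k * \<delta>) \<omega>. f n) =
    (\<Sum>i<k. \<Sum>n = num_plays T 0 (real i * \<delta>) \<omega>..<num_plays T 0 (real (Suc i) * \<delta>) \<omega>. f n :: real)"
proof (induction k)
  case 0
  then show ?case by (simp add: num_plays_0[OF \<omega>])
next
  case (Suc k)
  have "num_plays T 0 (real k * \<delta>) \<omega> \<le> num_plays T 0 (real (Suc k) * \<delta>) \<omega>"
    using \<delta> by (intro num_plays_mono[OF \<omega>] mult_right_mono) auto
  from sum.atLeastLessThan_concat[OF _ this, of 0 f] show ?case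
    using Suc by (simp add: atLeast0LessThan)
qed

text \<open>Over a short interval, player 0 plays \<open>\<delta>\<close> times on average, and with his initial
  neighbourhood unless a neighbour plays too.\<close>

lemma chance_rate_grid:
  assumes \<delta>: "0 < \<delta>"
  shows "AE \<omega> in M. eventually (\<lambda>k. \<bar>(\<Sum>n<num_plays T 0 (real k * \<delta>) \<omega>. chance n \<omega>)
    - (LINT x|\<pi>. p (nbhd 0 x)) * (real k * \<delta>)\<bar> \<le> 3 * \<delta>\<^sup>2 * real k) sequentially"
proof -
  define \<phi> where "\<phi> k \<omega> = p (nbhd 0 (X (real k * \<delta>) \<omega>))" for k \<omega>
  define inc where "inc j k \<omega> = real (increment j (real k * \<delta>) (real (Suc k) * \<delta>) \<omega>)" for j k \<omega>
  have cont: "continuous_on UNIV (\<lambda>x :: config. p (nbhd 0 x))"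
    by (rule depends_on_continuous[of "{- 1, 1}"]) (auto simp: depends_on_def nbhd_def status_def)
  have \<phi>_meas: "\<phi> k \<in> borel_measurable (F (real k * \<delta>))" for k
    unfolding \<phi>_def[abs_def] using \<delta> by (intro continuous_X_measurable cont) simp
  have \<phi>_le: "\<bar>\<phi> k \<omega>\<bar> \<le> 1" for k \<omega>
    using p01[OF nbhd_le_3] by (auto simp: \<phi>_def)
  \<comment> \<open>With constant weight 1 and two players, the product of the counts has mean
    \<open>\<delta>\<^sup>2\<close>.\<close>
  have pair: "AE \<omega> in M. (\<lambda>n. (\<Sum>k<n. inc 0 k \<omega> * inc j k \<omega> - \<delta>\<^sup>2) / real n) \<longlonglongrightarrow> 0"
    if "j \<in> {- 1, 1}" for j
    using strong_law_increments[OF \<delta>, of "{0, j}" "\<lambda>_ _. 1"] that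
    by (auto simp: inc_def power2_eq_square)
  have "AE \<omega> in M. (\<lambda>n. (\<Sum>k<n. \<phi> k \<omega> * (inc 0 k \<omega> - \<delta>)) / real n) \<longlonglongrightarrow> 0"
    using strong_law_increments[OF \<delta> _ \<phi>_meas \<phi>_le, of "{0}"] by (simp add: inc_def)
  moreover have "AE \<omega> in M. (\<lambda>n. (\<Sum>k<n. inc 0 k \<omega> * inc (- 1) k \<omega> - \<delta>\<^sup>2) / real n) \<longlonglongrightarrow> 0"
    by (rule pair) simp
  moreover have "AE \<omega> in M. (\<lambda>n. (\<Sum>k<n. inc 0 k \<omega> * inc 1 k \<omega> - \<delta>\<^sup>2) / real n) \<longlonglongrightarrow> 0"
    by (rule pair) simp
  moreover have "AE \<omega> in M. (\<lambda>n. (\<Sum>k<n. \<phi> k \<omega>) / real n) \<longlonglongrightarrow> (LINT x|\<pi>. p (nbhd 0 x))"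
    unfolding \<phi>_def by (rule strong_law_skeleton[OF \<delta> cont])
  ultimately show ?thesis
    using AE_space
  proof eventually_elim
    case (elim \<omega>)
    let ?c = "LINT x|\<pi>. p (nbhd 0 x)"
    let ?R = "\<lambda>k. \<Sum>n<num_plays T 0 (real k * \<delta>) \<omega>. chance n \<omega>"
    let ?H = "\<lambda>i. \<Sum>n = num_plays T 0 (real i * \<delta>) \<omega>..<num_plays T 0 (real (Suc i) * \<delta>) \<omega>. chance n \<omega>"
    let ?A = "\<lambda>k. \<Sum>i<k. \<phi> i \<omega> * (inc 0 i \<omega> - \<delta>)"
    let ?B = "\<lambda>j k. \<Sum>i<k. inc 0 i \<omega> * inc j i \<omega> - \<delta>\<^sup>2"
    let ?C = "\<lambda>k. \<Sum>i<k. \<phi> i \<omega>"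
    \<comment> \<open>\<open>?A\<close> is the fluctuation of the play counts around \<delta>,
      \<open>?B\<close> the centred joint plays with a neighbour, and \<open>?C\<close> the average
      along the skeleton; the last term is the mean of the joint plays with both neighbours.\<close>
    have bound: "\<bar>?R k - ?c * (real k * \<delta>)\<bar> \<le> \<bar>?A k\<bar> + ?B (- 1) k + ?B 1 k + \<delta> * \<bar>?C k - ?c * real k\<bar> + 2 * \<delta>\<^sup>2 * real k" for k
    proof -
      have "\<bar>?H i - inc 0 i \<omega> * \<phi> i \<omega>\<bar> \<le> inc 0 i \<omega> * (inc (- 1) i \<omega> + inc 1 i \<omega>)" for i
        unfolding inc_def \<phi>_def by (rule chances_in_interval) (use elim \<delta> in auto)
      then have "\<bar>\<Sum>i<k. ?H i - inc 0 i \<omega> * \<phi> i \<omega>\<bar> \<le> (\<Sum>i<k. inc 0 i \<omega> * (inc (- 1) i \<omega> + inc 1 i \<omega>))"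
        by (intro order_trans[OF sum_abs sum_mono])
      also have "\<dots> = ?B (- 1) k + ?B 1 k + 2 * \<delta>\<^sup>2 * real k"
        by (simp add: sum_subtractf distrib_left sum.distrib)
      finally have 1: "\<bar>\<Sum>i<k. ?H i - inc 0 i \<omega> * \<phi> i \<omega>\<bar> \<le> ?B (- 1) k + ?B 1 k + 2 * \<delta>\<^sup>2 * real k" .
      have "?R k = (\<Sum>i<k. ?H i)"
        by (rule num_plays_sum) (use elim \<delta> in auto)
      then have "?R k - ?c * (real k * \<delta>) = (\<Sum>i<k. ?H i - inc 0 i \<omega> * \<phi> i \<omega>) + ?A k + \<delta> * (?C k - ?c * real k)"
        by (simp add: sum_subtractf right_diff_distrib sum_distrib_left mult.commute mult.left_commute)
      moreover have "\<bar>\<delta> * (?C k - ?c * real k)\<bar> = \<delta> * \<bar>?C k - ?c * real k\<bar>"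
        using \<delta> by (simp add: abs_mult)
      ultimately show ?thesis using 1 by linarith
    qed
    have C: "(\<lambda>k. ?C k / real k - ?c) \<longlonglongrightarrow> 0"
      using tendsto_diff[OF elim(4) tendsto_const[of ?c]] by simp
    have "(\<lambda>k. \<bar>?A k / real k\<bar> + ?B (- 1) k / real k + ?B 1 k / real k + \<delta> * \<bar>?C k / real k - ?c\<bar>) \<longlonglongrightarrow> \<bar>0\<bar> + 0 + 0 + \<delta> * \<bar>0\<bar>"
      by (intro tendsto_intros elim(1-3) C)
    then have "(\<lambda>k. \<bar>?A k / real k\<bar> + ?B (- 1) k / real k + ?B 1 k / real k + \<delta> * \<bar>?C k / real k - ?c\<bar>) \<longlonglongrightarrow> 0"
      by simp
    \<comment> \<open>The vanishing terms are allowed one further \<open>\<delta>\<^sup>2\<close> on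
      average, which turns the 2 of \<open>bound\<close> into 3.\<close>
    from order_tendstoD(2)[OF this, of "\<delta>\<^sup>2"] \<delta>
    have "eventually (\<lambda>k. \<bar>?A k / real k\<bar> + ?B (- 1) k / real k + ?B 1 k / real k + \<delta> * \<bar>?C k / real k - ?c\<bar> < \<delta>\<^sup>2) sequentially"
      by simp
    then show ?case
      using eventually_gt_at_top[of "0 :: nat"]
    proof eventually_elim
      case (elim k)
      have "(\<bar>?A k / real k\<bar> + ?B (- 1) k / real k + ?B 1 k / real k + \<delta> * \<bar>?C k / real k - ?c\<bar>) * real k
          = \<bar>?A k\<bar> + ?B (- 1) k + ?B 1 k + \<delta> * \<bar>?C k - ?c * real k\<bar>"
      proof -
        have "\<bar>?C k / real k - ?c\<bar> * real k = \<bar>(?C k / real k - ?c) * real k\<bar>"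
          by (simp add: abs_mult)
        also have "(?C k / real k - ?c) * real k = ?C k - ?c * real k"
          using elim(2) by (simp add: left_diff_distrib)
        finally show ?thesis
          using elim(2) by (simp add: distrib_right mult.assoc)
      qed
      moreover have "(\<bar>?A k / real k\<bar> + ?B (- 1) k / real k + ?B 1 k / real k + \<delta> * \<bar>?C k / real k - ?c\<bar>) * real k \<le> \<delta>\<^sup>2 * real k"
        using elim by (intro mult_right_mono) auto
      ultimately show ?case using bound[of k] by linarith
    qed
  qed
qed

text \<open>The centred count divided by k tends to 0; the weaker bound and the factor 1 give it the
  form that \<open>mono_growth_rate\<close> takes, with growth rate 1.\<close>

lemma num_plays_rate_grid:
  assumes \<delta>: "0 < \<delta>"
  shows "AE \<omega> in M. eventually (\<lambda>k. \<bar>real (num_plays T 0 (real k * \<delta>) \<omega>) - 1 * (real k * \<delta>)\<bar>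
    \<le> 3 * \<delta>\<^sup>2 * real k) sequentially"
proof -
  define inc where "inc k \<omega> = real (increment 0 (real k * \<delta>) (real (Suc k) * \<delta>) \<omega>)" for k \<omega>
  have "AE \<omega> in M. (\<lambda>n. (\<Sum>k<n. inc k \<omega> - \<delta>) / real n) \<longlonglongrightarrow> 0"
    using strong_law_increments[OF \<delta>, of "{0}" "\<lambda>_ _. 1"] by (simp add: inc_def)
  then show ?thesis
    using AE_space
  proof eventually_elim
    case (elim \<omega>)
    have eq: "real (num_plays T 0 (real k * \<delta>) \<omega>) - 1 * (real k * \<delta>) = (\<Sum>i<k. inc i \<omega> - \<delta>)" for k
      using num_plays_sum[OF elim(2) \<delta>, of "\<lambda>_. 1" k] by (simp add: inc_def increment_def sum_subtractf)
    have "0 < 3 * \<delta>\<^sup>2" using \<delta> by simp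
    from tendstoD[OF elim(1) this]
    have "eventually (\<lambda>k. \<bar>(\<Sum>i<k. inc i \<omega> - \<delta>) / real k\<bar> < 3 * \<delta>\<^sup>2) sequentially"
      by (simp add: dist_real_def)
    then show ?case
      using eventually_gt_at_top[of "0 :: nat"]
      by eventually_elim (simp only: eq, simp add: abs_divide divide_less_eq less_imp_le)
  qed
qed

text \<open>Wins minus losses is twice the wins minus all plays, and the wins split into their
  chances and a centred part.\<close>

lemma profit_eq:
  assumes "\<omega> \<in> space M"
  shows "profit X T 0 t \<omega> = 2 * (\<Sum>n<num_plays T 0 t \<omega>. win 0 n \<omega> - chance n \<omega>)
    + 2 * (\<Sum>n<num_plays T 0 t \<omega>. chance n \<omega>) - real (num_plays T 0 t \<omega>)"
proof -
  let ?N = "num_plays T 0 t \<omega>"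
  let ?W = "{n \<in> {..<?N}. X (T 0 n \<omega>) \<omega> 0}" and ?L = "{n \<in> {..<?N}. \<not> X (T 0 n \<omega>) \<omega> 0}"
  have wins: "{n. T 0 n \<omega> \<le> t \<and> X (T 0 n \<omega>) \<omega> 0} = ?W"
    and losses: "{n. T 0 n \<omega> \<le> t \<and> \<not> X (T 0 n \<omega>) \<omega> 0} = ?L"
    using num_plays_less_iff[OF assms] by auto
  have "card (?W \<union> ?L) = card ?W + card ?L"
    by (rule card_Un_disjoint) auto
  moreover have "?W \<union> ?L = {..<?N}" by auto
  ultimately have N: "real ?N = real (card ?W) + real (card ?L)"
    by (simp only: card_lessThan of_nat_add)
  have "(\<Sum>n<?N. win 0 n \<omega>) = (\<Sum>n\<in>?W. 1)"
    using assms by (intro sum.mono_neutral_cong_right) (auto simp: win_def)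
  then have win: "(\<Sum>n<?N. win 0 n \<omega>) = real (card ?W)" by simp
  show ?thesis
    unfolding profit_def wins losses sum_subtractf win N by (simp add: right_diff_distrib)
qed

lemma profit_rate:
  "AE \<omega> in M. ((\<lambda>t. profit X T 0 t \<omega> / t) \<longlongrightarrow> 2 * (LINT x|\<pi>. p (nbhd 0 x)) - 1) at_top"
proof -
  let ?c = "LINT x|\<pi>. p (nbhd 0 x)"
  have c: "0 \<le> ?c"
    using p01[OF nbhd_le_3] by (intro Bochner_Integration.integral_nonneg) auto
  \<comment> \<open>The meshes form a countable family, so the exceptional null set can be chosen
    once for all of them.\<close>
  have "AE \<omega> in M. \<forall>r. eventually (\<lambda>k. \<bar>(\<Sum>n<num_plays T 0 (real k * (1 / real (Suc r))) \<omega>. chance n \<omega>)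
    - ?c * (real k * (1 / real (Suc r)))\<bar> \<le> 3 * (1 / real (Suc r))\<^sup>2 * real k) sequentially"
    unfolding AE_all_countable by (intro allI chance_rate_grid) simp
  moreover have "AE \<omega> in M. \<forall>r. eventually (\<lambda>k. \<bar>real (num_plays T 0 (real k * (1 / real (Suc r))) \<omega>)
    - 1 * (real k * (1 / real (Suc r)))\<bar> \<le> 3 * (1 / real (Suc r))\<^sup>2 * real k) sequentially"
    unfolding AE_all_countable by (intro allI num_plays_rate_grid) simp
  moreover have "AE \<omega> in M. (\<lambda>n. (\<Sum>k<n. win 0 k \<omega> - chance k \<omega>) / real n) \<longlonglongrightarrow> 0"
    unfolding chance_def by (rule strong_law_win)
  ultimately show ?thesis
    using AE_space
  proof eventually_elim
    case (elim \<omega>)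
    let ?N = "\<lambda>t. num_plays T 0 t \<omega>"
    let ?R = "\<lambda>t. \<Sum>n<?N t. chance n \<omega>"
    let ?D = "\<lambda>n. (\<Sum>k<n. win 0 k \<omega> - chance k \<omega>)"
    have R: "((\<lambda>t. ?R t / t) \<longlongrightarrow> ?c) at_top"
    proof (rule mono_growth_rate[OF _ c])
      show "?R s \<le> ?R t" if "s \<le> t" for s t
        using num_plays_mono[OF elim(4) that, of 0] chance_01 by (intro sum_mono2) auto
    qed (use elim(1) in blast)
    have N: "((\<lambda>t. real (?N t) / t) \<longlongrightarrow> 1) at_top"
    proof (rule mono_growth_rate)
      show "real (?N s) \<le> real (?N t)" if "s \<le> t" for s t
        using num_plays_mono[OF elim(4) that, of 0] by simp
    qed (use elim(2) in \<open>simp, blast\<close>)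
    have "filterlim ?N at_top at_top"
      unfolding filterlim_at_top
    proof
      fix n
      have "n \<le> ?N t" if "T 0 n \<omega> \<le> t" for t
        using num_plays_less_iff[OF elim(4), of n 0 t] that by simp
      then show "eventually (\<lambda>t. n \<le> ?N t) at_top"
        unfolding eventually_at_top_linorder by blast
    qed
    from filterlim_compose[OF elim(3) this]
    have "((\<lambda>t. ?D (?N t) / real (?N t)) \<longlongrightarrow> 0) at_top" .
    from tendsto_mult[OF this N]
    have prod: "((\<lambda>t. ?D (?N t) / real (?N t) * (real (?N t) / t)) \<longlongrightarrow> 0) at_top"
      unfolding mult_zero_left .
    \<comment> \<open>Before the first play the sum is empty, so the identity survives the division
      by 0.\<close>
    have "?D (?N t) / real (?N t) * (real (?N t) / t) = ?D (?N t) / t" for t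
      by (cases "?N t = 0") auto
    then have D: "((\<lambda>t. ?D (?N t) / t) \<longlongrightarrow> 0) at_top"
      using prod by (simp only:)
    have "((\<lambda>t. 2 * (?D (?N t) / t) + 2 * (?R t / t) - real (?N t) / t) \<longlongrightarrow> 2 * 0 + 2 * ?c - 1) at_top"
      by (intro tendsto_intros D R N)
    moreover have "2 * (?D (?N t) / t) + 2 * (?R t / t) - real (?N t) / t = profit X T 0 t \<omega> / t" for t
      unfolding profit_eq[OF elim(4)] by (simp add: add_divide_distrib diff_divide_distrib)
    ultimately show ?case by simp
  qed
qed

end

theorem theorem13:
  fixes p :: "nat \<Rightarrow> real"
    and K :: "real \<Rightarrow> config \<Rightarrow> config measure"
    and \<pi> :: "config measure"
    and M :: "'w measure" and F :: "real \<Rightarrow> 'w measure"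
    and X :: "real \<Rightarrow> 'w \<Rightarrow> config"
    and T :: "int \<Rightarrow> nat \<Rightarrow> 'w \<Rightarrow> real"
    and \<mu> :: real
  assumes "\<And>m. m \<le> 3 \<Longrightarrow> p m \<in> {0..1}"
    and "spin_system p K"
    and "ergodic K \<pi>"
    and "spin_play M F p K X T"
    and "\<mu> = (\<Sum>u=0..1. \<Sum>v=0..1. marginal2 \<pi> (-1) 1 u v * (p (2 * u + v) - (1 - p (2 * u + v))))"
  shows "(AE \<omega> in M. ((\<lambda>t. profit X T 0 t \<omega> / t) \<longlongrightarrow> \<mu>) at_top)
    \<and> (\<forall>i u v. marginal2 \<pi> (i - 1) (i + 1) u v = marginal2 \<pi> (-1) 1 u v)
    \<and> \<mu> = 2 * (marginal2 \<pi> (-1) 1 0 0 * p 0 + marginal2 \<pi> (-1) 1 0 1 * p 1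
               + marginal2 \<pi> (-1) 1 1 0 * p 2 + marginal2 \<pi> (-1) 1 1 1 * p 3) - 1
    \<and> (\<forall>i u. marginal1 \<pi> i u = marginal1 \<pi> 0 u)
    \<and> \<mu> = marginal1 \<pi> 0 1 - marginal1 \<pi> 0 0
    \<and> \<mu> = 2 * marginal1 \<pi> 0 1 - 1"
proof -
  interpret spin_play M F p K X T by fact
  interpret ergodic_spin_play p K \<pi> M F X T
    by unfold_locales (fact assms(2), fact assms(3), fact assms(1))
  let ?m = "marginal2 \<pi> (-1) 1"
  have "\<mu> = ?m 0 0 * (2 * p 0 - 1) + ?m 0 1 * (2 * p 1 - 1) + ?m 1 0 * (2 * p 2 - 1) + ?m 1 1 * (2 * p 3 - 1)"
    unfolding assms(5) by (simp add: numeral_3_eq_3 numeral_2_eq_2 algebra_simps)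
  \<comment> \<open>The subtracted bracket is the total mass of the two-dimensional marginal, which
    is 1.\<close>
  also have "\<dots> = 2 * (?m 0 0 * p 0 + ?m 0 1 * p 1 + ?m 1 0 * p 2 + ?m 1 1 * p 3)
      - (?m 0 0 + ?m 0 1 + ?m 1 0 + ?m 1 1)"
    by (simp add: algebra_simps)
  finally have \<mu>: "\<mu> = 2 * (?m 0 0 * p 0 + ?m 0 1 * p 1 + ?m 1 0 * p 2 + ?m 1 1 * p 3) - 1"
    unfolding marginal2_sum .
  then have mean: "\<mu> = 2 * (LINT x|\<pi>. p (nbhd 0 x)) - 1"
    unfolding integral_nbhd[of p] .
  then have "\<mu> = 2 * marginal1 \<pi> 0 1 - 1"
    unfolding integral_win_probability .
  moreover have "marginal1 \<pi> 0 1 - marginal1 \<pi> 0 0 = 2 * marginal1 \<pi> 0 1 - 1"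
    using marginal1_sum by simp
  ultimately show ?thesis
    using profit_rate marginal1_shift marginal2_shift \<mu> unfolding mean[symmetric] by simp
qed

end
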